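(* Let $K$ be an algebraically closed field of characteristic different from $2$, and let $w\in W(C_n)$ ($n>1$) be elliptic. Then $w$ has universal spin $-1$, and $w$ has adjoint spin $1$ if and only if $w^r=-I\in W(C_n)$ for some $r\in\mathbb{Z}$.
   Context: For a semisimple algebraic $K$-group $G$ with root system $\Phi$, maximal torus $T$ and Weyl group $W=N_G(T)/T$, an element $w\in W$ is elliptic if it has no eigenvalue $1$ in the reflection representation. It is known that if $w$ is elliptic of order $d$, then all representatives of $w$ in $N_G(T)$ have the same order, which is either $d$ or $2d$. Say $w$ has spin $1$ in $G$ if all its representatives have order $d$, and spin $-1$ in $G$ if all its representatives have order $2d$. Universal spin is the spin in the universal (simply connected) group $G_u$ with root system $\Phi$, here $\mathrm{Sp}_{2n}(K)$; adjoint spin is the spin in the adjoint group $G_a$, here $\mathrm{PSp}_{2n}(K)$. $-I$ denotes the negative of the identity in the reflection representation, which lies in $W(C_n)$. *)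

theory Defs
  imports
    "Jordan_Normal_Form.Char_Poly"
    "HOL-Algebra.Generated_Groups"
    "HOL-Algebra.Group_Action"
    "HOL-Algebra.Multiplicative_Group"
begin

definition GL :: "'a::field itself \<Rightarrow> nat \<Rightarrow> 'a mat monoid" where
  "GL ty n = units_of (ring_mat ty n ())"


text \<open>The Weyl group \<open>W(C\<^sub>n)\<close> in its reflection representation on \<open>\<real>\<^sup>n\<close>; indices run from 0.\<close>

definition roots_C :: "nat \<Rightarrow> real vec set" where
  "roots_C n =
     {a \<cdot>\<^sub>v unit_vec n i + b \<cdot>\<^sub>v unit_vec n j | a b i j.
        i < j \<and> j < n \<and> a \<in> {1, -1} \<and> b \<in> {1, -1}} \<union>
     {a \<cdot>\<^sub>v unit_vec n i | a i. i < n \<and> a \<in> {2, -2}}"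

text \<open>Matrix of \<open>v \<mapsto> v - 2 (v \<bullet> \<alpha>) / (\<alpha> \<bullet> \<alpha>) \<alpha>\<close>.\<close>

definition refl_mat :: "nat \<Rightarrow> real vec \<Rightarrow> real mat" where
  "refl_mat n \<alpha> = mat n n (\<lambda>(i, j).
     (if i = j then 1 else 0) - 2 * (\<alpha> $ i) * (\<alpha> $ j) / (\<alpha> \<bullet> \<alpha>))"

definition weyl_C :: "nat \<Rightarrow> real mat monoid" where
  "weyl_C n = (GL TYPE(real) n)
     \<lparr>carrier := generate (GL TYPE(real) n) (refl_mat n ` roots_C n)\<rparr>"

definition elliptic :: "real mat \<Rightarrow> bool" where
  "elliptic w \<longleftrightarrow> \<not> eigenvalue w 1"


text \<open>Symplectic form with Gram matrix \<open>(0 I; -I 0)\<close>. Its diagonal maximal torus consists of the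
  matrices \<open>diag(t\<^sub>1, \<dots>, t\<^sub>n, t\<^sub>1\<inverse>, \<dots>, t\<^sub>n\<inverse>)\<close>.\<close>

definition symp_form :: "nat \<Rightarrow> 'k::field mat" where
  "symp_form n = four_block_mat (0\<^sub>m n n) (1\<^sub>m n) (- 1\<^sub>m n) (0\<^sub>m n n)"

definition Sp :: "'k::field itself \<Rightarrow> nat \<Rightarrow> 'k mat monoid" where
  "Sp ty n = (GL ty (2 * n))
     \<lparr>carrier := {A \<in> carrier (GL ty (2 * n)). transpose_mat A * symp_form n * A = symp_form n}\<rparr>"

definition Sp_torus :: "'k::field itself \<Rightarrow> nat \<Rightarrow> 'k mat set" where
  "Sp_torus ty n = {t \<in> carrier (Sp ty n). diagonal_mat t}"

text \<open>An integral vector \<open>a\<close> stands for the character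
  \<open>diag(t\<^sub>1, \<dots>, t\<^sub>n, t\<^sub>1\<inverse>, \<dots>, t\<^sub>n\<inverse>) \<mapsto> t\<^sub>1\<^bsup>a\<^sub>1\<^esup> \<cdots> t\<^sub>n\<^bsup>a\<^sub>n\<^esup>\<close>; the roots of the torus are exactly the
  characters given by \<open>roots_C n\<close>.\<close>

definition Sp_char :: "nat \<Rightarrow> real vec \<Rightarrow> 'k::field mat \<Rightarrow> 'k" where
  "Sp_char n a t = (\<Prod>i<n. (t $$ (i, i)) powi \<lfloor>a $ i\<rfloor>)"


text \<open>The adjoint group is the quotient of \<open>Sp\<close> by its centre. Its elements are cosets \<open>{g, -g}\<close>, and
  a root takes the same value at \<open>t\<close> and \<open>-t\<close>, so it is a character of the image torus.\<close>

definition Sp_centre :: "'k::field itself \<Rightarrow> nat \<Rightarrow> 'k mat set" where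
  "Sp_centre ty n = {1\<^sub>m (2 * n), - 1\<^sub>m (2 * n)}"

definition PSp :: "'k::field itself \<Rightarrow> nat \<Rightarrow> 'k mat set monoid" where
  "PSp ty n = Sp ty n Mod Sp_centre ty n"

definition PSp_torus :: "'k::field itself \<Rightarrow> nat \<Rightarrow> 'k mat set set" where
  "PSp_torus ty n = (\<lambda>t. Sp_centre ty n #>\<^bsub>Sp ty n\<^esub> t) ` Sp_torus ty n"

definition PSp_char :: "nat \<Rightarrow> real vec \<Rightarrow> 'k::field mat set \<Rightarrow> 'k" where
  "PSp_char n a X = the_elem (Sp_char n a ` X)"


text \<open>Here \<open>ev \<alpha> t\<close> is the value of the root \<open>\<alpha>\<close> at \<open>t \<in> T\<close>. An element \<open>g\<close> of the normalizer acts on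
  characters by \<open>(g\<chi>)(t) = \<chi>(g\<inverse> t g)\<close>. This permutes the roots, and the induced permutation determines
  the coset \<open>g T\<close>, which identifies \<open>N\<^sub>G(T)/T\<close> with the Weyl group of the root system. The
  representatives of \<open>w\<close> are the elements of the coset corresponding to \<open>w\<close>.\<close>

definition weyl_reps ::
    "'g monoid \<Rightarrow> 'g set \<Rightarrow> real vec set \<Rightarrow> (real vec \<Rightarrow> 'g \<Rightarrow> 'k) \<Rightarrow> real mat \<Rightarrow> 'g set" where
  "weyl_reps G T \<Phi> ev w =
     {g \<in> normalizer G T. \<forall>\<alpha>\<in>\<Phi>. \<forall>t\<in>T.
        ev \<alpha> (inv\<^bsub>G\<^esub> g \<otimes>\<^bsub>G\<^esub> t \<otimes>\<^bsub>G\<^esub> g) = ev (w *\<^sub>v \<alpha>) t}"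

definition Sp_reps :: "'k::field itself \<Rightarrow> nat \<Rightarrow> real mat \<Rightarrow> 'k mat set" where
  "Sp_reps ty n w = weyl_reps (Sp ty n) (Sp_torus ty n) (roots_C n) (Sp_char n) w"

definition PSp_reps :: "'k::field itself \<Rightarrow> nat \<Rightarrow> real mat \<Rightarrow> 'k mat set set" where
  "PSp_reps ty n w = weyl_reps (PSp ty n) (PSp_torus ty n) (roots_C n) (PSp_char n) w"

text \<open>Spin is a relation, and \<open>group.ord\<close> is 0 for elements of infinite order.\<close>

definition has_spin :: "'g monoid \<Rightarrow> 'g set \<Rightarrow> nat \<Rightarrow> int \<Rightarrow> bool" where
  "has_spin G R d s \<longleftrightarrow>
     (s = 1 \<and> (\<forall>g\<in>R. group.ord G g = d)) \<or>
     (s = - 1 \<and> (\<forall>g\<in>R. group.ord G g = 2 * d))"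

definition universal_spin :: "'k::field itself \<Rightarrow> nat \<Rightarrow> real mat \<Rightarrow> int \<Rightarrow> bool" where
  "universal_spin ty n w s \<longleftrightarrow>
     has_spin (Sp ty n) (Sp_reps ty n w) (group.ord (weyl_C n) w) s"

definition adjoint_spin :: "'k::field itself \<Rightarrow> nat \<Rightarrow> real mat \<Rightarrow> int \<Rightarrow> bool" where
  "adjoint_spin ty n w s \<longleftrightarrow>
     has_spin (PSp ty n) (PSp_reps ty n w) (group.ord (weyl_C n) w) s"

end

theory Submission
  imports Defs
begin

text \<open>Let \<open>\<epsilon>\<^sub>1, \<dots>, \<epsilon>\<^sub>n, -\<epsilon>\<^sub>1, \<dots>, -\<epsilon>\<^sub>n\<close> be the weights of the standard basis of the symplectic
  space. A representative \<open>g\<close> of \<open>w\<close> permutes the basis vectors up to scalars in the way \<open>w\<close> permutes the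
  weights. If \<open>w\<close> is elliptic, the sum of the orbit of each weight vanishes, so some power of \<open>w\<close>
  negates that weight; let \<open>l\<close> be the least such exponent. The period of the weight is \<open>2l\<close>, and because
  \<open>g\<^sup>l\<close> preserves the form while interchanging two dual basis lines, \<open>g\<^bsup>2l\<^esup>\<close> is \<open>-1\<close> on the basis
  vector. Hence, whenever \<open>w\<^bsup>2e\<^esup> = 1\<close>, the sign by which \<open>g\<^bsup>2e\<^esup>\<close> acts on a basis vector equals the
  sign by which \<open>w\<^sup>e\<close> acts on its weight. For \<open>2e = d\<close>, the order of \<open>w\<close>, this gives \<open>g\<^sup>d \<noteq> 1\<close>, and
  \<open>g\<^sup>d = -1\<close> exactly when \<open>w\<^bsup>d/2\<^esup> = -1\<close>; for \<open>e = d\<close> it gives \<open>g\<^bsup>2d\<^esup> = 1\<close>.\<close>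

section \<open>General linear groups, and comparison of matrices on basis vectors\<close>

lemma GL_group: "group (GL (ty :: 'a::field itself) n)"
proof -
  interpret ring "ring_mat ty n ()"
    using ring_mat[of n "()", where 'a = 'a] by (simp add: ring_mat_def)
  show ?thesis unfolding GL_def by (rule units_group)
qed

lemma GL_mult [simp]: "A \<otimes>\<^bsub>GL ty n\<^esub> B = A * B"
  by (simp add: GL_def units_of_def ring_mat_simps)

lemma GL_one [simp]: "\<one>\<^bsub>GL ty n\<^esub> = 1\<^sub>m n"
  by (simp add: GL_def units_of_def ring_mat_simps)

lemma GL_carrierD: "A \<in> carrier (GL ty n) \<Longrightarrow> A \<in> carrier_mat n n"
  by (simp add: GL_def units_of_def ring_mat_def Units_def)

text \<open>Over a field a one-sided inverse of a square matrix is two-sided.\<close>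

lemma GL_carrierI:
  fixes A :: "'a::field mat"
  assumes "A \<in> carrier_mat n n" "B \<in> carrier_mat n n" "A * B = 1\<^sub>m n"
  shows "A \<in> carrier (GL ty n)"
  using assms mat_mult_left_right_inverse[OF assms]
  by (auto simp: GL_def units_of_def ring_mat_def Units_def)

text \<open>Powers depend only on multiplication and unit, so the carrier \<open>H\<close> is left
  open: the lemma serves both \<open>weyl_C\<close> and \<open>Sp\<close>, which restrict the
  carrier of \<open>GL\<close>.\<close>

lemma GL_pow:
  assumes "A \<in> carrier_mat n n"
  shows "A [^]\<^bsub>(GL ty n)\<lparr>carrier := H\<rparr>\<^esub> (k::nat) = A ^\<^sub>m k"
  using assms by (induction k) (auto simp: nat_pow_def)

lemma mult_mat_vec_ext:
  fixes A B :: "'a::semiring_1 mat"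
  assumes "A \<in> carrier_mat n n" "B \<in> carrier_mat n n"
    and "\<And>i. i < n \<Longrightarrow> A *\<^sub>v unit_vec n i = B *\<^sub>v unit_vec n i"
  shows "A = B"
proof (rule eq_matI)
  fix i j assume "i < dim_row B" "j < dim_col B"
  with assms have ij: "i < n" "j < n" by auto
  have "(A *\<^sub>v unit_vec n j) $ i = (B *\<^sub>v unit_vec n j) $ i" using assms(3) ij by simp
  thus "A $$ (i,j) = B $$ (i,j)" using ij assms(1,2) by simp
qed (use assms in auto)

subsection \<open>The Weyl group as signed permutations\<close>

definition opp :: "nat \<Rightarrow> nat \<Rightarrow> nat" where
  "opp n i = (if i < n then i + n else i - n)"

lemma opp_less [simp]: "i < 2 * n \<Longrightarrow> opp n i < 2 * n"
  by (auto simp: opp_def)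

lemma opp_opp [simp]: "i < 2 * n \<Longrightarrow> opp n (opp n i) = i"
  by (auto simp: opp_def)

lemma opp_neq [simp]: "i < 2 * n \<Longrightarrow> opp n i \<noteq> i" "i < 2 * n \<Longrightarrow> i \<noteq> opp n i"
  by (auto simp: opp_def)

lemma opp_lt_iff: "i < 2 * n \<Longrightarrow> opp n i < n \<longleftrightarrow> \<not> i < n"
  by (auto simp: opp_def)

lemma opp_inj: "i < 2 * n \<Longrightarrow> j < 2 * n \<Longrightarrow> opp n i = opp n j \<longleftrightarrow> i = j"
  by (metis opp_opp)

text \<open>The weight of the \<open>i\<close>-th basis vector of the symplectic space, and \<open>opp\<close> the index of its dual.\<close>

definition eps :: "nat \<Rightarrow> nat \<Rightarrow> real vec" where
  "eps n i = (if i < n then unit_vec n i else - unit_vec n (i - n))"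

lemma eps_carrier [simp]: "eps n i \<in> carrier_vec n" "dim_vec (eps n i) = n"
  by (auto simp: eps_def)

lemma eps_opp: "i < 2 * n \<Longrightarrow> eps n (opp n i) = - eps n i"
  by (auto simp: eps_def opp_def)

lemma eps_index:
  "i < 2 * n \<Longrightarrow> k < n \<Longrightarrow>
    eps n i $ k = (if k = i then 1 else if k = opp n i then - 1 else 0)"
  by (auto simp: eps_def opp_def)

lemma eps_inj:
  assumes "i < 2 * n" "j < 2 * n"
  shows "eps n i = eps n j \<longleftrightarrow> i = j"
proof
  assume eq: "eps n i = eps n j"
  define k where "k = (if i < n then i else i - n)"
  have k: "k < n" using assms by (auto simp: k_def)
  have "eps n i $ k = eps n j $ k" using eq by simp
  thus "i = j" using assms k unfolding eps_index[OF assms(1) k] eps_index[OF assms(2) k]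
    by (auto simp: k_def opp_def split: if_splits)
qed simp

lemma eps_neq_uminus: "i < 2 * n \<Longrightarrow> eps n i \<noteq> - eps n i"
  by (metis eps_opp eps_inj opp_neq(1) opp_less)

lemma eps_scalar:
  assumes "i < 2 * n" "j < 2 * n"
  shows "eps n i \<bullet> eps n j = (if i = j then 1 else if i = opp n j then - 1 else 0)"
proof -
  define k where "k = (if j < n then j else j - n)"
  have k: "k < n" using assms by (auto simp: k_def)
  have "eps n i \<bullet> eps n j = (if j < n then eps n i $ k else - eps n i $ k)"
    using assms k by (auto simp: eps_def[of n j] k_def)
  thus ?thesis using assms k unfolding eps_index[OF assms(1) k]
    by (auto simp: k_def opp_def split: if_splits)
qed

text \<open>Allowing \<open>i = j\<close> gives the long roots, and
  \<open>j \<noteq> opp n i\<close> excludes the zero sum. With the signs absorbed into the indices,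
  reflections and characters can be computed from two weights.\<close>

lemma roots_C_iff:
  "\<alpha> \<in> roots_C n \<longleftrightarrow>
    (\<exists>i j. i < 2 * n \<and> j < 2 * n \<and> j \<noteq> opp n i \<and> \<alpha> = eps n i + eps n j)"
proof
  have signed: "\<exists>k<2*n. a \<cdot>\<^sub>v unit_vec n i = eps n k \<and> (k = i \<or> k = i + n)"
    if "i < n" "a \<in> {1,-1}" for a i
    using that by (intro exI[of _ "if a = 1 then i else i + n"]) (auto simp: eps_def)
  assume "\<alpha> \<in> roots_C n"
  then consider (short) a b i j where "i < j" "j < n" "a \<in> {1,-1}" "b \<in> {1,-1}"
      "\<alpha> = a \<cdot>\<^sub>v unit_vec n i + b \<cdot>\<^sub>v unit_vec n j"
    | (long) a i where "i < n" "a \<in> {2,-2}" "\<alpha> = a \<cdot>\<^sub>v unit_vec n i"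
    unfolding roots_C_def by blast
  thus "\<exists>i j. i < 2 * n \<and> j < 2 * n \<and> j \<noteq> opp n i \<and> \<alpha> = eps n i + eps n j"
  proof cases
    case short
    obtain k where k: "k < 2*n" "a \<cdot>\<^sub>v unit_vec n i = eps n k" "k = i \<or> k = i + n"
      using signed[of i a] short by auto
    obtain l where l: "l < 2*n" "b \<cdot>\<^sub>v unit_vec n j = eps n l" "l = j \<or> l = j + n"
      using signed[of j b] short by auto
    show ?thesis using k l short by (intro exI[of _ k] exI[of _ l]) (auto simp: opp_def)
  next
    case long
    obtain k where k: "k < 2*n" "(a/2) \<cdot>\<^sub>v unit_vec n i = eps n k" "k = i \<or> k = i + n"
      using signed[of i "a/2"] long by auto
    have "\<alpha> = (a/2) \<cdot>\<^sub>v unit_vec n i + (a/2) \<cdot>\<^sub>v unit_vec n i"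
      unfolding long by (subst add_smult_distrib_vec[symmetric]) simp
    thus ?thesis using k by (intro exI[of _ k] exI[of _ k]) auto
  qed
next
  have unsigned: "\<exists>a k. a \<in> {1,-1} \<and> k < n \<and> eps n i = a \<cdot>\<^sub>v unit_vec n k \<and>
    i = (if a = 1 then k else k + n)" if "i < 2*n" for i
    using that by (intro exI[of _ "if i < n then 1 else -1"] exI[of _ "if i < n then i else i - n"])
      (auto simp: eps_def)
  assume "\<exists>i j. i < 2 * n \<and> j < 2 * n \<and> j \<noteq> opp n i \<and> \<alpha> = eps n i + eps n j"
  then obtain i j where ij: "i < 2 * n" "j < 2 * n" "j \<noteq> opp n i" "\<alpha> = eps n i + eps n j" by blast
  obtain a k where a: "a \<in> {1,-1}" "k < n" "eps n i = a \<cdot>\<^sub>v unit_vec n k" "i = (if a = 1 then k else k + n)"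
    using unsigned[OF ij(1)] by blast
  obtain b l where b: "b \<in> {1,-1}" "l < n" "eps n j = b \<cdot>\<^sub>v unit_vec n l" "j = (if b = 1 then l else l + n)"
    using unsigned[OF ij(2)] by blast
  consider "k < l" | "l < k" | "k = l" by linarith
  thus "\<alpha> \<in> roots_C n"
  proof cases
    case 1
    have "\<alpha> = a \<cdot>\<^sub>v unit_vec n k + b \<cdot>\<^sub>v unit_vec n l" using ij a b by simp
    thus ?thesis using 1 a(1,2) b(1,2) unfolding roots_C_def by blast
  next
    case 2
    have "\<alpha> = b \<cdot>\<^sub>v unit_vec n l + a \<cdot>\<^sub>v unit_vec n k"
      using ij a b by (simp add: comm_add_vec[of _ n])
    thus ?thesis using 2 a(1,2) b(1,2) unfolding roots_C_def by blast
  next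
    case 3
    hence "a = b" using a b ij by (auto simp: opp_def split: if_splits)
    hence "\<alpha> = (2*a) \<cdot>\<^sub>v unit_vec n k" using a b ij 3
      by (simp add: add_smult_distrib_vec[symmetric])
    moreover have "2 * a \<in> {2,-2}" using a by auto
    ultimately show ?thesis using a(2) unfolding roots_C_def by blast
  qed
qed

lemma refl_mat_carrier [simp]: "refl_mat n \<alpha> \<in> carrier_mat n n"
  "dim_row (refl_mat n \<alpha>) = n" "dim_col (refl_mat n \<alpha>) = n"
  by (simp_all add: refl_mat_def)

lemma refl_mat_mult:
  assumes "\<alpha> \<in> carrier_vec n" "v \<in> carrier_vec n"
  shows "refl_mat n \<alpha> *\<^sub>v v = v - (2 * (v \<bullet> \<alpha>) / (\<alpha> \<bullet> \<alpha>)) \<cdot>\<^sub>v \<alpha>"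
proof (rule eq_vecI)
  fix i assume "i < dim_vec (v - (2 * (v \<bullet> \<alpha>) / (\<alpha> \<bullet> \<alpha>)) \<cdot>\<^sub>v \<alpha>)"
  hence i: "i < n" using assms by simp
  have "(refl_mat n \<alpha> *\<^sub>v v) $ i =
     (\<Sum>j<n. ((if i = j then 1 else 0) - 2 * \<alpha> $ i * \<alpha> $ j / (\<alpha> \<bullet> \<alpha>)) * v $ j)"
    using i assms by (simp add: refl_mat_def scalar_prod_def atLeast0LessThan)
  also have "\<dots> = (\<Sum>j<n. (if i = j then v $ j else 0) - 2 * \<alpha> $ i / (\<alpha> \<bullet> \<alpha>) * (v $ j * \<alpha> $ j))"
    by (rule sum.cong) (auto simp: algebra_simps)
  also have "\<dots> = v $ i - 2 * \<alpha> $ i / (\<alpha> \<bullet> \<alpha>) * (\<Sum>j<n. v $ j * \<alpha> $ j)"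
    using i by (simp add: sum_subtractf sum_distrib_left)
  also have "(\<Sum>j<n. v $ j * \<alpha> $ j) = v \<bullet> \<alpha>"
    using assms by (simp add: scalar_prod_def atLeast0LessThan)
  finally show "(refl_mat n \<alpha> *\<^sub>v v) $ i = (v - (2 * (v \<bullet> \<alpha>) / (\<alpha> \<bullet> \<alpha>)) \<cdot>\<^sub>v \<alpha>) $ i"
    using i assms by simp
qed (use assms in simp)

text \<open>A weight pairs nontrivially with the root only if its index is \<open>i\<close>,
  \<open>j\<close> or the opposite of one of these; all other weights are fixed. For a long root
  \<open>i = j\<close>, and the four cases agree in pairs.\<close>

lemma refl_mat_eps:
  assumes "i < 2 * n" "j < 2 * n" "j \<noteq> opp n i" "c < 2 * n"
  shows "refl_mat n (eps n i + eps n j) *\<^sub>v eps n c = eps n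
    (if c = i then opp n j else if c = j then opp n i
     else if c = opp n i then j else if c = opp n j then i else c)"
proof -
  let ?a = "eps n i + eps n j"
  have vs: "v \<bullet> ?a = v \<bullet> eps n i + v \<bullet> eps n j" if "v \<in> carrier_vec n" for v
    using that by (simp add: scalar_prod_add_distrib[of _ n])
  \<comment> \<open>The squared length is 4 for long roots and 2 for short ones, since distinct
    non-opposite weights are orthogonal.\<close>
  have aa: "?a \<bullet> ?a = (if i = j then 4 else 2)"
    using assms by (auto simp: add_scalar_prod_distrib[of _ n] vs eps_scalar opp_inj)
  have ca: "eps n c \<bullet> ?a = eps n c \<bullet> eps n i + eps n c \<bullet> eps n j" by (simp add: vs)
  have "refl_mat n ?a *\<^sub>v eps n c = eps n c - (2 * (eps n c \<bullet> ?a) / (?a \<bullet> ?a)) \<cdot>\<^sub>v ?a"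
    by (rule refl_mat_mult) auto
  thus ?thesis
    unfolding aa ca using assms
    by (auto simp: eps_scalar opp_inj eps_opp intro!: eq_vecI)
qed

text \<open>Stated on all \<open>2 * n\<close> weights, so that products and powers compose as maps
  of indices. Injectivity is not built in; where it matters it comes from invertibility of
  \<open>w\<close>.\<close>

definition signed_perm :: "nat \<Rightarrow> real mat \<Rightarrow> bool" where
  "signed_perm n w \<longleftrightarrow> w \<in> carrier_mat n n \<and> (\<forall>i<2*n. \<exists>k<2*n. w *\<^sub>v eps n i = eps n k)"

lemma eps_ext:
  assumes "A \<in> carrier_mat n n" "B \<in> carrier_mat n n"
    and "\<And>i. i < 2 * n \<Longrightarrow> A *\<^sub>v eps n i = B *\<^sub>v eps n i"
  shows "A = B"
proof (rule mult_mat_vec_ext[OF assms(1,2)])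
  fix i assume "i < n"
  thus "A *\<^sub>v unit_vec n i = B *\<^sub>v unit_vec n i" using assms(3)[of i] by (simp add: eps_def)
qed

text \<open>The index map found in \<open>refl_mat_eps\<close> is an involution, and the weights
  span. Being its own inverse puts a reflection into \<open>GL\<close> and settles the inverses in
  the generated group.\<close>

lemma refl_mat_root:
  assumes "\<alpha> \<in> roots_C n"
  shows "signed_perm n (refl_mat n \<alpha>)" "refl_mat n \<alpha> * refl_mat n \<alpha> = 1\<^sub>m n"
proof -
  obtain i j where ij: "i < 2 * n" "j < 2 * n" "j \<noteq> opp n i" and \<alpha>: "\<alpha> = eps n i + eps n j"
    using assms by (auto simp: roots_C_iff)
  let ?f = "\<lambda>c. if c = i then opp n j else if c = j then opp n i
     else if c = opp n i then j else if c = opp n j then i else c"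
  have f: "?f c < 2 * n" if "c < 2 * n" for c using that ij by auto
  show "signed_perm n (refl_mat n \<alpha>)"
    using refl_mat_eps[OF ij] f unfolding signed_perm_def \<alpha> by fastforce
  have ff: "?f (?f c) = c" if "c < 2 * n" for c
    using ij that opp_inj[OF ij(1,2)] opp_opp[of i n] opp_opp[of j n] opp_neq[of i n] opp_neq[of j n]
    by (auto split: if_splits)
  show "refl_mat n \<alpha> * refl_mat n \<alpha> = 1\<^sub>m n"
  proof (rule eps_ext)
    fix c assume c: "c < 2 * n"
    have "(refl_mat n \<alpha> * refl_mat n \<alpha>) *\<^sub>v eps n c = refl_mat n \<alpha> *\<^sub>v (refl_mat n \<alpha> *\<^sub>v eps n c)"
      by (rule assoc_mult_mat_vec) auto
    also have "\<dots> = eps n (?f (?f c))"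
      unfolding \<alpha> refl_mat_eps[OF ij c] refl_mat_eps[OF ij f[OF c]] ..
    finally show "(refl_mat n \<alpha> * refl_mat n \<alpha>) *\<^sub>v eps n c = 1\<^sub>m n *\<^sub>v eps n c"
      using ff[OF c] by simp
  qed (auto intro: mult_carrier_mat)
qed

lemma refl_mat_GL: "refl_mat n ` roots_C n \<subseteq> carrier (GL TYPE(real) n)"
  by (auto intro: GL_carrierI[OF _ _ refl_mat_root(2)])

lemma weyl_C_subgroup:
  "subgroup (generate (GL TYPE(real) n) (refl_mat n ` roots_C n)) (GL TYPE(real) n)"
  by (rule group.generate_is_subgroup[OF GL_group refl_mat_GL])

lemma weyl_C_group: "group (weyl_C n)"
  unfolding weyl_C_def by (rule subgroup.subgroup_is_group[OF weyl_C_subgroup GL_group])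

lemma signed_perm_mult:
  assumes "signed_perm n v" "signed_perm n w"
  shows "signed_perm n (v * w)"
  unfolding signed_perm_def
proof (intro conjI allI impI)
  show "v * w \<in> carrier_mat n n" using assms by (auto simp: signed_perm_def)
  fix i assume "i < 2 * n"
  then obtain k where k: "k < 2 * n" "w *\<^sub>v eps n i = eps n k" using assms by (auto simp: signed_perm_def)
  then obtain l where "l < 2 * n" "v *\<^sub>v eps n k = eps n l" using assms by (auto simp: signed_perm_def)
  moreover have "(v * w) *\<^sub>v eps n i = v *\<^sub>v (w *\<^sub>v eps n i)"
    by (rule assoc_mult_mat_vec) (use assms in \<open>auto simp: signed_perm_def\<close>)
  ultimately show "\<exists>l<2 * n. (v * w) *\<^sub>v eps n i = eps n l" using k by auto
qed

lemma weyl_C_carrierD: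
  assumes "w \<in> carrier (weyl_C n)"
  shows "signed_perm n w"
proof -
  have "w \<in> generate (GL TYPE(real) n) (refl_mat n ` roots_C n)"
    using assms by (simp add: weyl_C_def)
  thus ?thesis
  proof induction
    case one
    thus ?case by (auto simp: signed_perm_def)
  next
    case (incl h)
    thus ?case using refl_mat_root by auto
  next
    case (inv h)
    then obtain \<alpha> where \<alpha>: "\<alpha> \<in> roots_C n" "h = refl_mat n \<alpha>" by auto
    have "inv\<^bsub>GL TYPE(real) n\<^esub> h = h"
      using refl_mat_root(2)[OF \<alpha>(1)] refl_mat_GL \<alpha> by (intro group.inv_equality[OF GL_group]) auto
    thus ?case using refl_mat_root \<alpha> by auto
  next
    case (eng h1 h2)
    thus ?case by (simp add: signed_perm_mult)
  qed
qed

lemma finite_mat_entries: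
  assumes "finite S"
  shows "finite {A \<in> carrier_mat n m. \<forall>i<n. \<forall>j<m. A $$ (i,j) \<in> S}"
proof (rule finite_subset)
  show "finite (mat n m ` (({0..<n} \<times> {0..<m}) \<rightarrow>\<^sub>E S))"
    using assms by (intro finite_imageI finite_PiE) auto
  show "{A \<in> carrier_mat n m. \<forall>i<n. \<forall>j<m. A $$ (i,j) \<in> S} \<subseteq>
    mat n m ` (({0..<n} \<times> {0..<m}) \<rightarrow>\<^sub>E S)"
  proof
    fix A assume A: "A \<in> {A \<in> carrier_mat n m. \<forall>i<n. \<forall>j<m. A $$ (i,j) \<in> S}"
    hence "A = mat n m (restrict (\<lambda>p. A $$ p) ({0..<n} \<times> {0..<m}))" by (auto intro!: eq_matI)
    moreover have "restrict (\<lambda>p. A $$ p) ({0..<n} \<times> {0..<m}) \<in> ({0..<n} \<times> {0..<m}) \<rightarrow>\<^sub>E S"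
      using A by auto
    ultimately show "A \<in> mat n m ` (({0..<n} \<times> {0..<m}) \<rightarrow>\<^sub>E S)" by blast
  qed
qed

text \<open>Columns of \<open>w\<close> are weights, so all entries are 0, 1 or -1. Finiteness
  guarantees that the order of \<open>w\<close> is positive and not the default value 0.\<close>

lemma weyl_C_finite: "finite (carrier (weyl_C n))"
proof (rule finite_subset)
  show "carrier (weyl_C n) \<subseteq> {A \<in> carrier_mat n n. \<forall>i<n. \<forall>j<n. A $$ (i,j) \<in> {0,1,-1}}"
  proof clarify
    fix w assume "w \<in> carrier (weyl_C n)"
    hence w: "signed_perm n w" by (rule weyl_C_carrierD)
    have "w $$ (i,j) \<in> {0,1,-1}" if ij: "i < n" "j < n" for i j
    proof -
      have "j < 2 * n" using ij by simp
      then obtain k where k: "k < 2 * n" "w *\<^sub>v eps n j = eps n k" using w unfolding signed_perm_def by blast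
      have "w $$ (i,j) = (w *\<^sub>v eps n j) $ i"
        using w ij by (auto simp: eps_def signed_perm_def)
      thus ?thesis using k ij by (auto simp: eps_index)
    qed
    thus "w \<in> carrier_mat n n \<and> (\<forall>i<n. \<forall>j<n. w $$ (i,j) \<in> {0,1,-1})"
      using w by (auto simp: signed_perm_def)
  qed
qed (intro finite_mat_entries, simp)

lemma weyl_C_pow:
  assumes "w \<in> carrier (weyl_C n)"
  shows "w [^]\<^bsub>weyl_C n\<^esub> (k::nat) = w ^\<^sub>m k"
  unfolding weyl_C_def using weyl_C_carrierD[OF assms] by (intro GL_pow) (auto simp: signed_perm_def)

subsection \<open>The symplectic group and its torus\<close>

abbreviation sgn_form :: "nat \<Rightarrow> nat \<Rightarrow> 'a::ring_1" where
  "sgn_form n i \<equiv> (if i < n then 1 else - 1)"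

lemma symp_form_carrier [simp]: "symp_form n \<in> carrier_mat (2 * n) (2 * n)"
  "dim_row (symp_form n) = 2 * n" "dim_col (symp_form n) = 2 * n"
  by (auto simp: symp_form_def mult_2)

lemma symp_form_index:
  "i < 2 * n \<Longrightarrow> j < 2 * n \<Longrightarrow>
    symp_form n $$ (i, j) = (if j = opp n i then sgn_form n i else 0)"
  by (auto simp: symp_form_def opp_def)

text \<open>This is the form evaluated on columns \<open>i\<close> and \<open>j\<close>. Row
  \<open>k\<close> of the Gram matrix has its only nonzero entry in column \<open>opp n k\<close>,
  so the double sum collapses to a single one.\<close>

lemma symp_form_mult_index:
  fixes A :: "'a::field mat"
  assumes "A \<in> carrier_mat (2 * n) (2 * n)" "i < 2 * n" "j < 2 * n"
  shows "(transpose_mat A * symp_form n * A) $$ (i, j) =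
    (\<Sum>k<2*n. A $$ (k, i) * sgn_form n k * A $$ (opp n k, j))"
proof -
  have A: "dim_row A = 2 * n" "dim_col A = 2 * n" using assms by auto
  have "transpose_mat A * symp_form n * A = transpose_mat A * (symp_form n * A)"
    using assms by (intro assoc_mult_mat[of _ "2*n" "2*n" _ "2*n" _ "2*n"]) auto
  moreover have "(symp_form n * A) $$ (k, j) = sgn_form n k * A $$ (opp n k, j)" if "k < 2 * n" for k
  proof -
    have "(symp_form n * A) $$ (k, j) = (\<Sum>l<2*n. symp_form n $$ (k, l) * A $$ (l, j))"
      using assms that A by (simp add: scalar_prod_def atLeast0LessThan)
    also have "\<dots> = (\<Sum>l<2*n. if l = opp n k then sgn_form n k * A $$ (l, j) else 0)"
      using that by (intro sum.cong) (auto simp: symp_form_index)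
    finally show ?thesis using that by simp
  qed
  ultimately show ?thesis
    using assms A by (simp add: scalar_prod_def atLeast0LessThan mult.assoc)
qed

lemma GL_inv:
  assumes "A \<in> carrier (GL ty n)"
  shows "inv\<^bsub>GL ty n\<^esub> A \<in> carrier (GL ty n)"
    "A * inv\<^bsub>GL ty n\<^esub> A = 1\<^sub>m n" "inv\<^bsub>GL ty n\<^esub> A * A = 1\<^sub>m n"
  using group.inv_closed[OF GL_group assms] group.r_inv[OF GL_group assms]
    group.l_inv[OF GL_group assms] by auto

text \<open>Only the left factor is assumed to preserve \<open>J\<close>, so the identity serves
  products and, with \<open>A * B\<close> the unit, also inverses.\<close>

lemma preserves_form_mult:
  fixes A B J :: "'a::comm_ring_1 mat"
  assumes "A \<in> carrier_mat n n" "B \<in> carrier_mat n n" "J \<in> carrier_mat n n"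
    and "transpose_mat A * J * A = J"
  shows "transpose_mat (A * B) * J * (A * B) = transpose_mat B * J * B"
proof -
  have "transpose_mat (A * B) * J * (A * B) = transpose_mat B * (transpose_mat A * J * A) * B"
    using assms(1-3)
    by (simp add: transpose_mult[OF assms(1,2)] assoc_mult_mat[of _ n n _ n _ n])
  thus ?thesis using assms(4) by simp
qed

lemma Sp_subgroup:
  "subgroup {A \<in> carrier (GL ty (2 * n)). transpose_mat A * symp_form n * A = symp_form n}
    (GL ty (2 * n))"
proof (rule group.subgroupI[OF GL_group])
  fix a assume "a \<in> {A \<in> carrier (GL ty (2 * n)). transpose_mat A * symp_form n * A = symp_form n}"
  hence a: "a \<in> carrier (GL ty (2 * n))" "transpose_mat a * symp_form n * a = symp_form n" by auto
  let ?b = "inv\<^bsub>GL ty (2 * n)\<^esub> a"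
  note b = GL_inv[OF a(1)]
  have "symp_form n = transpose_mat (a * ?b) * symp_form n * (a * ?b)"
    unfolding b(2) by simp
  also have "\<dots> = transpose_mat ?b * symp_form n * ?b"
    using GL_carrierD[OF a(1)] GL_carrierD[OF b(1)] a(2) by (intro preserves_form_mult) auto
  finally show "?b \<in> {A \<in> carrier (GL ty (2 * n)). transpose_mat A * symp_form n * A = symp_form n}"
    using b by simp
next
  fix a b assume "a \<in> {A \<in> carrier (GL ty (2 * n)). transpose_mat A * symp_form n * A = symp_form n}"
    and "b \<in> {A \<in> carrier (GL ty (2 * n)). transpose_mat A * symp_form n * A = symp_form n}"
  hence ab: "a \<in> carrier (GL ty (2 * n))" "transpose_mat a * symp_form n * a = symp_form n"
     "b \<in> carrier (GL ty (2 * n))" "transpose_mat b * symp_form n * b = symp_form n" by auto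
  have "a * b \<in> carrier (GL ty (2 * n))"
    using group.subgroup_self[OF GL_group] subgroup.m_closed[of _ "GL ty (2*n)" a b] ab by fastforce
  moreover have "transpose_mat (a * b) * symp_form n * (a * b) = symp_form n"
    using preserves_form_mult[OF GL_carrierD[OF ab(1)] GL_carrierD[OF ab(3)] symp_form_carrier(1) ab(2)]
      ab(4) by simp
  ultimately show "a \<otimes>\<^bsub>GL ty (2 * n)\<^esub> b \<in>
      {A \<in> carrier (GL ty (2 * n)). transpose_mat A * symp_form n * A = symp_form n}"
    by simp
next
  have "1\<^sub>m (2 * n) \<in> carrier (GL ty (2 * n))"
    by (rule GL_carrierI[of _ _ "1\<^sub>m (2 * n)"]) auto
  thus "{A \<in> carrier (GL ty (2 * n)). transpose_mat A * symp_form n * A = symp_form n} \<noteq> {}"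
    by (intro ex_in_conv[THEN iffD1] exI[of _ "1\<^sub>m (2 * n)"]) simp
qed auto

lemma Sp_group: "group (Sp ty n)"
  unfolding Sp_def by (rule subgroup.subgroup_is_group[OF Sp_subgroup GL_group])

lemma Sp_mult [simp]: "A \<otimes>\<^bsub>Sp ty n\<^esub> B = A * B"
  by (simp add: Sp_def)

lemma Sp_one [simp]: "\<one>\<^bsub>Sp ty n\<^esub> = 1\<^sub>m (2 * n)"
  by (simp add: Sp_def)

text \<open>Membership in \<open>GL\<close> is recovered from the form: the Gram matrix
  \<open>J\<close> is orthogonal, so multiplying the invariance equation by its transpose exhibits
  an explicit left inverse of \<open>A\<close>.\<close>

lemma Sp_carrier_iff:
  fixes A :: "'k::field mat"
  shows "A \<in> carrier (Sp ty n) \<longleftrightarrow>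
    A \<in> carrier_mat (2 * n) (2 * n) \<and> transpose_mat A * symp_form n * A = symp_form n"
proof
  assume "A \<in> carrier (Sp ty n)"
  thus "A \<in> carrier_mat (2 * n) (2 * n) \<and> transpose_mat A * symp_form n * A = symp_form n"
    using GL_carrierD by (auto simp: Sp_def)
next
  assume A: "A \<in> carrier_mat (2 * n) (2 * n) \<and> transpose_mat A * symp_form n * A = symp_form n"
  let ?J = "symp_form n :: 'k mat"
  have JJ: "transpose_mat ?J * ?J = 1\<^sub>m (2 * n)"
  proof (rule eq_matI)
    fix i j assume "i < dim_row (1\<^sub>m (2 * n) :: 'k mat)" "j < dim_col (1\<^sub>m (2 * n) :: 'k mat)"
    hence ij: "i < 2 * n" "j < 2 * n" by auto
    have "(transpose_mat ?J * ?J) $$ (i, j) = (\<Sum>k<2*n. ?J $$ (k, i) * ?J $$ (k, j))"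
      using ij by (simp add: scalar_prod_def atLeast0LessThan)
    also have "\<dots> = (\<Sum>k<2*n. if k = opp n i then (if i = j then 1 else 0) else 0)"
      using ij by (intro sum.cong) (auto simp: symp_form_index)
    finally show "(transpose_mat ?J * ?J) $$ (i, j) = 1\<^sub>m (2 * n) $$ (i, j)"
      using ij by simp
  qed auto
  have Ac: "A \<in> carrier_mat (2 * n) (2 * n)" using A by simp
  define B where "B = transpose_mat ?J * (transpose_mat A * ?J)"
  have B: "B \<in> carrier_mat (2 * n) (2 * n)"
    unfolding B_def using Ac by (metis mult_carrier_mat symp_form_carrier(1) transpose_carrier_mat)
  have "B * A = transpose_mat ?J * (transpose_mat A * ?J * A)"
    unfolding B_def using Ac by (intro assoc_mult_mat[of _ "2*n" "2*n" _ "2*n" _ "2*n"]) auto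
  hence "B * A = 1\<^sub>m (2 * n)" unfolding conjunct2[OF A] JJ .
  hence "A \<in> carrier (GL ty (2 * n))"
    by (intro GL_carrierI[OF Ac B] mat_mult_left_right_inverse[OF B Ac])
  thus "A \<in> carrier (Sp ty n)" using A by (simp add: Sp_def)
qed

lemma Sp_carrierD: "A \<in> carrier (Sp ty n) \<Longrightarrow> A \<in> carrier_mat (2 * n) (2 * n)"
  by (simp add: Sp_carrier_iff)

lemma Sp_entries_iff:
  fixes A :: "'k::field mat"
  assumes "A \<in> carrier_mat (2 * n) (2 * n)"
  shows "A \<in> carrier (Sp ty n) \<longleftrightarrow>
    (\<forall>i<2*n. \<forall>j<2*n. (\<Sum>k<2*n. A $$ (k, i) * sgn_form n k * A $$ (opp n k, j)) =
      (if j = opp n i then sgn_form n i else 0))"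
proof -
  have "transpose_mat A * symp_form n * A = symp_form n \<longleftrightarrow>
    (\<forall>i<2*n. \<forall>j<2*n. (transpose_mat A * symp_form n * A) $$ (i, j) = symp_form n $$ (i, j))"
    using assms by (auto intro!: eq_matI simp del: index_mult_mat(1))
  thus ?thesis
    using assms by (simp add: Sp_carrier_iff symp_form_mult_index symp_form_index del: index_mult_mat)
qed

lemma Sp_pow: "A \<in> carrier (Sp ty n) \<Longrightarrow> A [^]\<^bsub>Sp ty n\<^esub> (k::nat) = A ^\<^sub>m k"
  unfolding Sp_def[of ty n] by (intro GL_pow) (auto dest: GL_carrierD)

section \<open>The diagonal torus and the values of its characters\<close>

lemma Sp_torus_iff:
  fixes t :: "'k::field mat"
  shows "t \<in> Sp_torus ty n \<longleftrightarrow>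
    t \<in> carrier_mat (2 * n) (2 * n) \<and> diagonal_mat t \<and>
    (\<forall>i<2*n. t $$ (i, i) * t $$ (opp n i, opp n i) = 1)"
proof -
  {
    assume t: "t \<in> carrier_mat (2 * n) (2 * n)" "diagonal_mat t"
    have "(\<Sum>k<2*n. t $$ (k, i) * sgn_form n k * t $$ (opp n k, j)) =
       (if j = opp n i then sgn_form n i * (t $$ (i, i) * t $$ (opp n i, opp n i)) else 0)"
      if ij: "i < 2 * n" "j < 2 * n" for i j
    proof -
      have off: "t $$ (a, b) = 0" if "a < 2 * n" "b < 2 * n" "a \<noteq> b" for a b
        using t that by (auto simp: diagonal_mat_def)
      \<comment> \<open>Only \<open>k = i\<close> survives in a diagonal matrix, and the remaining
        factor vanishes unless \<open>j = opp n i\<close>. The sign then occurs on both sides and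
        cancels.\<close>
      have "(\<Sum>k<2*n. t $$ (k, i) * sgn_form n k * t $$ (opp n k, j)) =
        (\<Sum>k<2*n. if k = i then t $$ (i, i) * sgn_form n i * t $$ (opp n i, j) else 0)"
        using ij by (intro sum.cong) (auto simp: off)
      thus ?thesis using ij off[of "opp n i" j] by auto
    qed
    hence "t \<in> carrier (Sp ty n) \<longleftrightarrow> (\<forall>i<2*n. t $$ (i, i) * t $$ (opp n i, opp n i) = 1)"
      unfolding Sp_entries_iff[OF t(1)] by (auto simp del: mult_minus_left)
  }
  thus ?thesis unfolding Sp_torus_def using Sp_carrierD by blast
qed

text \<open>From here on root values are products of two diagonal entries, and the floors and
  integer exponents of \<open>Sp_char\<close> disappear. Splitting the exponents is legitimate
  because torus entries are nonzero.\<close>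

lemma Sp_char_eps:
  fixes t :: "'k::field mat"
  assumes t: "t \<in> Sp_torus ty n" and ij: "i < 2 * n" "j < 2 * n"
  shows "Sp_char n (eps n i + eps n j) t = t $$ (i, i) * t $$ (j, j)"
proof -
  \<comment> \<open>The integer coordinates of the weight \<open>eps n i\<close>.\<close>
  define a where "a i k = (if k = i then 1 else if k = opp n i then - 1 else 0 :: int)" for i k
  have tt: "t $$ (i, i) * t $$ (opp n i, opp n i) = 1" if "i < 2 * n" for i
    using t that by (auto simp: Sp_torus_iff)
  have single: "(\<Prod>k<n. t $$ (k, k) powi a i k) = t $$ (i, i)" if i: "i < 2 * n" for i
  proof -
    define k where "k = (if i < n then i else i - n)"
    have k: "k < n" using i by (auto simp: k_def)
    have "(\<Prod>l<n. t $$ (l, l) powi a i l) = (\<Prod>l<n. if l = k then t $$ (i, i) else 1)"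
    proof (rule prod.cong)
      fix l assume "l \<in> {..<n}"
      hence l: "l < n" by simp
      \<comment> \<open>A negative weight has exponent -1 at coordinate \<open>i - n\<close>; the
        torus relation turns that inverse into the entry at \<open>i\<close>.\<close>
      have "\<not> i < n \<Longrightarrow> inverse (t $$ (i - n, i - n)) = t $$ (i, i)"
        using tt[OF i] by (intro inverse_unique) (auto simp: opp_def mult.commute)
      thus "t $$ (l, l) powi a i l = (if l = k then t $$ (i, i) else 1)"
        using l i by (auto simp: a_def k_def opp_def power_int_minus)
    qed simp
    thus ?thesis using k by simp
  qed
  have "Sp_char n (eps n i + eps n j) t = (\<Prod>k<n. t $$ (k, k) powi (a i k + a j k))"
    unfolding Sp_char_def
  proof (rule prod.cong)
    fix k assume "k \<in> {..<n}"
    hence "(eps n i + eps n j) $ k = of_int (a i k + a j k)"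
      using ij by (auto simp: eps_index a_def)
    thus "t $$ (k, k) powi \<lfloor>(eps n i + eps n j) $ k\<rfloor> = t $$ (k, k) powi (a i k + a j k)" by simp
  qed simp
  also have "\<dots> = (\<Prod>k<n. t $$ (k, k) powi a i k * t $$ (k, k) powi a j k)"
  proof (rule prod.cong)
    fix k assume "k \<in> {..<n}"
    hence "t $$ (k, k) \<noteq> 0" using tt[of k] by auto
    thus "t $$ (k, k) powi (a i k + a j k) = t $$ (k, k) powi a i k * t $$ (k, k) powi a j k"
      by (simp add: power_int_add)
  qed simp
  finally show ?thesis using single ij by (simp add: prod.distrib)
qed

subsection \<open>Lifts of Weyl group elements\<close>

text \<open>\<open>g\<close> maps each basis vector into the line of the basis vector whose weight is given by \<open>w\<close>.\<close>

definition lifts :: "nat \<Rightarrow> 'k::field mat \<Rightarrow> real mat \<Rightarrow> bool" where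
  "lifts n g w \<longleftrightarrow> (\<forall>i<2*n. \<forall>k<2*n. g $$ (k, i) \<noteq> 0 \<longrightarrow> w *\<^sub>v eps n i = eps n k)"

lemma lifts_one: "lifts n (1\<^sub>m (2 * n)) (1\<^sub>m n)"
  by (auto simp: lifts_def)

text \<open>A nonzero entry of the product forces a nonzero summand, whose intermediate index links
  the two weight maps.\<close>

lemma lifts_mult:
  assumes "g \<in> carrier_mat (2 * n) (2 * n)" "h \<in> carrier_mat (2 * n) (2 * n)"
    and "v \<in> carrier_mat n n" "w \<in> carrier_mat n n" and "lifts n g v" "lifts n h w"
  shows "lifts n (g * h) (v * w)"
  unfolding lifts_def
proof (intro allI impI)
  fix i k assume ik: "i < 2 * n" "k < 2 * n" and "(g * h) $$ (k, i) \<noteq> 0"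
  hence "(\<Sum>l<2*n. g $$ (k, l) * h $$ (l, i)) \<noteq> 0"
    using assms by (simp add: scalar_prod_def atLeast0LessThan)
  then obtain l where "l < 2 * n" "g $$ (k, l) * h $$ (l, i) \<noteq> 0"
    by (meson sum.neutral lessThan_iff)
  hence "w *\<^sub>v eps n i = eps n l" "v *\<^sub>v eps n l = eps n k"
    using assms ik by (auto simp: lifts_def)
  moreover have "(v * w) *\<^sub>v eps n i = v *\<^sub>v (w *\<^sub>v eps n i)"
    using assms by (intro assoc_mult_mat_vec) auto
  ultimately show "(v * w) *\<^sub>v eps n i = eps n k" by simp
qed

lemma lifts_pow:
  assumes "g \<in> carrier_mat (2 * n) (2 * n)" "w \<in> carrier_mat n n" "lifts n g w"
  shows "lifts n (g ^\<^sub>m m) (w ^\<^sub>m m)"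
proof (induction m)
  case 0
  show ?case using assms lifts_one by simp
next
  case (Suc m)
  thus ?case using assms by (auto intro: lifts_mult)
qed

lemma diagonal_mult_index:
  fixes t :: "'a::semiring_0 mat"
  assumes "t \<in> carrier_mat n n" "diagonal_mat t" "g \<in> carrier_mat n n" "k < n" "i < n"
  shows "(t * g) $$ (k, i) = t $$ (k, k) * g $$ (k, i)" "(g * t) $$ (k, i) = g $$ (k, i) * t $$ (i, i)"
proof -
  have off: "t $$ (a, b) = 0" if "a < n" "b < n" "a \<noteq> b" for a b
    using assms that by (auto simp: diagonal_mat_def)
  have "(t * g) $$ (k, i) = (\<Sum>j<n. t $$ (k, j) * g $$ (j, i))"
    using assms by (simp add: scalar_prod_def atLeast0LessThan)
  also have "\<dots> = (\<Sum>j<n. if j = k then t $$ (k, k) * g $$ (k, i) else 0)"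
    using assms by (intro sum.cong) (auto simp: off)
  finally show "(t * g) $$ (k, i) = t $$ (k, k) * g $$ (k, i)" using assms by simp
  have "(g * t) $$ (k, i) = (\<Sum>j<n. g $$ (k, j) * t $$ (j, i))"
    using assms by (simp add: scalar_prod_def atLeast0LessThan)
  also have "\<dots> = (\<Sum>j<n. if j = i then g $$ (k, i) * t $$ (i, i) else 0)"
    using assms by (intro sum.cong) (auto simp: off)
  finally show "(g * t) $$ (k, i) = g $$ (k, i) * t $$ (i, i)" using assms by simp
qed

text \<open>Squares of weights are roots, so a torus element separating the squares of the weights is enough
  to recover the permutation of the weights from the action on roots.\<close>

lemma alg_closed_ex_power4_neq_one:
  "\<exists>c::'k::alg_closed_field. c \<noteq> 0 \<and> c\<^sup>2 \<noteq> 1 \<and> c ^ 4 \<noteq> 1"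
proof -
  \<comment> \<open>A root \<open>c\<close> of X^5 - X - 1 satisfies c (c^4 - 1) = 1, which excludes
    c = 0 and c^4 = 1 in every characteristic.\<close>
  let ?p = "[:- 1, - 1, 0, 0, 0, 1::'k:]"
  obtain c where "poly ?p c = 0" using alg_closed_imp_poly_has_root[of ?p] by auto
  hence c: "c * (c ^ 4 - 1) = 1" by (simp add: algebra_simps power_numeral_reduce)
  have "c\<^sup>2 \<noteq> 1"
  proof
    assume "c\<^sup>2 = 1"
    hence "c ^ 4 = 1" by (simp add: power4_eq_xxxx power2_eq_square)
    thus False using c by simp
  qed
  thus ?thesis using c by (intro exI[of _ c]) auto
qed

text \<open>The hypothesis asks only for some torus element \<open>s\<close> with
  \<open>t * g = g * s\<close>. It can thus be met in \<open>Sp\<close> and also from the adjoint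
  group, where \<open>s\<close> is determined only up to sign.\<close>

lemma lifts_of_char:
  fixes g :: "'k::alg_closed_field mat"
  assumes w: "signed_perm n w" and g: "g \<in> carrier_mat (2 * n) (2 * n)"
    and conj: "\<And>t. t \<in> Sp_torus ty n \<Longrightarrow> \<exists>s\<in>Sp_torus ty n. t * g = g * s \<and>
      (\<forall>\<alpha>\<in>roots_C n. Sp_char n \<alpha> s = Sp_char n (w *\<^sub>v \<alpha>) t)"
  shows "lifts n g w"
  unfolding lifts_def
proof (intro allI impI)
  fix i k assume ik: "i < 2 * n" "k < 2 * n" and gki: "g $$ (k, i) \<noteq> 0"
  obtain c :: 'k where c: "c \<noteq> 0" "c\<^sup>2 \<noteq> 1" "c ^ 4 \<noteq> 1" using alg_closed_ex_power4_neq_one by blast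
  obtain l where l: "l < 2 * n" "w *\<^sub>v eps n i = eps n l" using w ik by (auto simp: signed_perm_def)
  \<comment> \<open>The squared entries of \<open>t\<close> are c^2 at \<open>l\<close>, c^(-2) at
    the opposite index and 1 elsewhere; by the choice of \<open>c\<close> the value c^2 occurs at
    \<open>l\<close> only.\<close>
  define t where "t = mat (2 * n) (2 * n) (\<lambda>(a, b). if a \<noteq> b then 0 else
    if a = l then c else if a = opp n l then inverse c else 1)"
  have t: "t \<in> Sp_torus ty n"
    using c l by (auto simp: t_def Sp_torus_iff diagonal_mat_def opp_inj)
  obtain s where s: "s \<in> Sp_torus ty n" "t * g = g * s"
    and ch: "\<And>\<alpha>. \<alpha> \<in> roots_C n \<Longrightarrow> Sp_char n \<alpha> s = Sp_char n (w *\<^sub>v \<alpha>) t" using conj[OF t] by blast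
  have wc: "w \<in> carrier_mat n n" using w by (simp add: signed_perm_def)
  \<comment> \<open>The long root at \<open>i\<close> has the square of the entry of
    \<open>s\<close> as its value.\<close>
  have "eps n i + eps n i \<in> roots_C n" using ik unfolding roots_C_iff
    by (intro exI[of _ i]) auto
  hence "Sp_char n (eps n i + eps n i) s = Sp_char n (eps n l + eps n l) t"
    using ch l by (simp add: mult_add_distrib_mat_vec[OF wc])
  hence "(s $$ (i, i))\<^sup>2 = (t $$ (l, l))\<^sup>2"
    using Sp_char_eps[OF s(1) ik(1) ik(1)] Sp_char_eps[OF t l(1) l(1)] by (simp add: power2_eq_square)
  hence sc: "(s $$ (i, i))\<^sup>2 = c\<^sup>2" using l by (simp add: t_def)
  have td: "t \<in> carrier_mat (2 * n) (2 * n)" "diagonal_mat t"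
    and sd: "s \<in> carrier_mat (2 * n) (2 * n)" "diagonal_mat s"
    using s(1) t by (auto simp: Sp_torus_iff)
  \<comment> \<open>Compare the entries at \<open>(k, i)\<close> of \<open>t * g = g * s\<close> and
    cancel the nonzero entry of \<open>g\<close>.\<close>
  have "t $$ (k, k) = s $$ (i, i)"
    using gki s(2) diagonal_mult_index(1)[OF td g ik(2,1)] diagonal_mult_index(2)[OF sd g ik(2,1)]
    by simp
  hence "(t $$ (k, k))\<^sup>2 = c\<^sup>2" using sc by simp
  moreover have "(inverse c)\<^sup>2 \<noteq> c\<^sup>2"
  proof
    assume "(inverse c)\<^sup>2 = c\<^sup>2"
    hence "c\<^sup>2 * c\<^sup>2 = (c * inverse c)\<^sup>2" by (simp only: power_mult_distrib)
    hence "c ^ 4 = 1" using c by (simp add: power4_eq_xxxx power2_eq_square mult.assoc)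
    thus False using c by simp
  qed
  ultimately have "k = l" using c ik by (auto simp: t_def split: if_splits)
  thus "w *\<^sub>v eps n i = eps n k" using l by simp
qed

subsection \<open>Powers of lifts of elliptic elements\<close>

lemma pow_mat_mult_vec_add:
  fixes A :: "'a::semiring_1 mat"
  assumes "A \<in> carrier_mat n n" "v \<in> carrier_vec n"
  shows "A ^\<^sub>m (j + k) *\<^sub>v v = A ^\<^sub>m j *\<^sub>v (A ^\<^sub>m k *\<^sub>v v)"
proof -
  have "A ^\<^sub>m (j + k) = A ^\<^sub>m j * A ^\<^sub>m k"
  proof (induction k)
    case 0
    show ?case using assms pow_carrier_mat[OF assms(1), of j] by simp
  next
    case (Suc k)
    thus ?case using assms by (simp add: assoc_mult_mat[of _ n n _ n _ n] pow_carrier_mat)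
  qed
  thus ?thesis using assms by (simp add: assoc_mult_mat_vec[of _ n n _ n] pow_carrier_mat)
qed

lemma signed_perm_pow: "signed_perm n w \<Longrightarrow> signed_perm n (w ^\<^sub>m k)"
proof (induction k)
  case 0
  thus ?case by (auto simp: signed_perm_def)
qed (simp add: signed_perm_mult)

lemma mult_mat_vec_uminus:
  fixes A :: "'a::ring_1 mat"
  assumes "A \<in> carrier_mat n m" "v \<in> carrier_vec m"
  shows "A *\<^sub>v (- v) = - (A *\<^sub>v v)"
  using assms by (intro eq_vecI) auto

text \<open>The sum of the orbit of a weight is fixed by \<open>w\<close>, so it vanishes; hence some member of the
  orbit cancels the contribution of the weight itself.\<close>

lemma elliptic_orbit_uminus:
  assumes w: "signed_perm n w" and ell: "elliptic w" and d: "d > 0" "w ^\<^sub>m d = 1\<^sub>m n"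
    and i: "i < 2 * n"
  shows "\<exists>m. w ^\<^sub>m m *\<^sub>v eps n i = - eps n i"
proof (rule ccontr)
  assume none: "\<nexists>m. w ^\<^sub>m m *\<^sub>v eps n i = - eps n i"
  have wc: "w \<in> carrier_mat n n" using w by (simp add: signed_perm_def)
  define f where "f m = w ^\<^sub>m m *\<^sub>v eps n i" for m
  have f0: "f 0 = eps n i" and fd: "f d = eps n i" using wc d by (auto simp: f_def)
  have fc: "f m \<in> carrier_vec n" for m
    unfolding f_def using pow_carrier_mat[OF wc] by (intro mult_mat_vec_carrier[of _ n n]) auto
  have fS: "w *\<^sub>v f m = f (Suc m)" for m
    using pow_mat_mult_vec_add[OF wc, of "eps n i" 1 m] wc by (simp add: f_def)
  define v where "v = vec n (\<lambda>j. \<Sum>m<d. f m $ j)"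
  have "w *\<^sub>v v = 1 \<cdot>\<^sub>v v"
  proof (rule eq_vecI)
    fix j assume "j < dim_vec (1 \<cdot>\<^sub>v v)"
    hence j: "j < n" by (simp add: v_def)
    have "(w *\<^sub>v v) $ j = (\<Sum>k<n. \<Sum>m<d. w $$ (j, k) * f m $ k)"
      using j wc by (simp add: v_def scalar_prod_def atLeast0LessThan sum_distrib_left)
    also have "\<dots> = (\<Sum>m<d. \<Sum>k<n. w $$ (j, k) * f m $ k)" by (rule sum.swap)
    also have "\<dots> = (\<Sum>m<d. f (Suc m) $ j)"
      unfolding fS[symmetric]
      using j wc carrier_vecD[OF fc] by (simp add: scalar_prod_def atLeast0LessThan)
    \<comment> \<open>Shifting the index by one only exchanges the summand \<open>f 0\<close> for
      the equal vector \<open>f d\<close>.\<close>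
    also have "\<dots> = (\<Sum>m<d. f m $ j)"
      using sum.lessThan_Suc_shift[of "\<lambda>m. f m $ j" d] f0 fd by simp
    finally show "(w *\<^sub>v v) $ j = (1 \<cdot>\<^sub>v v) $ j" using j by (simp add: v_def)
  qed (use wc in \<open>simp add: v_def\<close>)
  moreover have "v \<in> carrier_vec n" by (simp add: v_def)
  ultimately have "v = 0\<^sub>v n"
    using ell wc unfolding elliptic_def eigenvalue_def eigenvector_def by auto
  define k where "k = (if i < n then i else i - n)"
  have k: "k < n" using i by (auto simp: k_def)
  define sg where "sg = eps n i $ k"
  have sg: "sg = 1 \<or> sg = - 1" using k i by (auto simp: sg_def eps_index k_def opp_def)
  \<comment> \<open>At the coordinate where the starting weight is nonzero, only its negative could
    contribute with the opposite sign, and that is excluded by assumption.\<close>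
  have nonneg: "sg * f m $ k \<ge> 0" for m
  proof -
    obtain l where l: "l < 2 * n" "f m = eps n l"
      using signed_perm_pow[OF w] i unfolding signed_perm_def f_def by blast
    have "l \<noteq> opp n i" using none l i by (metis eps_opp f_def)
    thus ?thesis using l k i by (auto simp: sg_def eps_index k_def opp_def)
  qed
  have "0 < sg * f 0 $ k" using sg by (auto simp: f0 sg_def)
  also have "\<dots> \<le> (\<Sum>m<d. sg * f m $ k)"
    using d nonneg by (intro member_le_sum) auto
  also have "\<dots> = sg * v $ k" using k by (simp add: v_def sum_distrib_left)
  finally show False using \<open>v = 0\<^sub>v n\<close> k by simp
qed

text \<open>Two negations restore the weight, so exponents may be reduced modulo
  \<open>2 * l\<close>. A nonzero remainder fixing the weight would produce a negating exponent
  below the least one.\<close>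

lemma least_uminus_period:
  assumes w: "w \<in> carrier_mat n n" and i: "i < 2 * n"
    and ex: "\<exists>m. w ^\<^sub>m m *\<^sub>v eps n i = - eps n i"
  shows "\<exists>l>0. w ^\<^sub>m l *\<^sub>v eps n i = - eps n i \<and>
    (\<forall>k. w ^\<^sub>m k *\<^sub>v eps n i = eps n i \<longrightarrow> 2 * l dvd k)"
proof -
  define f where "f m = w ^\<^sub>m m *\<^sub>v eps n i" for m
  define l where "l = (LEAST m. f m = - eps n i)"
  have f0: "f 0 = eps n i" using w by (simp add: f_def)
  have add: "f (j + k) = w ^\<^sub>m j *\<^sub>v f k" for j k
    unfolding f_def by (rule pow_mat_mult_vec_add[OF w]) simp
  have neg: "w ^\<^sub>m j *\<^sub>v (- eps n i) = - f j" for j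
    unfolding f_def by (rule mult_mat_vec_uminus[OF pow_carrier_mat[OF w]]) simp
  have ne: "eps n i \<noteq> - eps n i" using eps_neq_uminus[OF i] .
  have fl: "f l = - eps n i" unfolding l_def by (rule LeastI_ex) (use ex in \<open>simp add: f_def\<close>)
  have least: "l \<le> m" if "f m = - eps n i" for m
    unfolding l_def using that by (rule Least_le)
  have l0: "l > 0" using fl f0 ne by (cases "l = 0") auto
  have f2l: "f (2 * l) = eps n i" using add[of l l] neg[of l] fl by (simp add: mult_2)
  have per: "f (r + 2 * l * q) = f r" for r q
  proof (induction q)
    case (Suc q)
    have "f (r + 2 * l * Suc q) = f ((r + 2 * l * q) + 2 * l)" by (simp add: algebra_simps)
    also have "\<dots> = f (r + 2 * l * q)" unfolding add[of _ "2 * l"] f2l by (simp add: f_def)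
    finally show ?case using Suc by simp
  qed simp
  have "2 * l dvd k" if fk: "f k = eps n i" for k
  proof (rule ccontr)
    define r where "r = k mod (2 * l)"
    assume "\<not> 2 * l dvd k"
    hence r: "0 < r" "r < 2 * l" using l0 by (auto simp: r_def dvd_eq_mod_eq_0)
    have fr: "f r = eps n i" using per[of r "k div (2 * l)"] fk by (simp add: r_def)
    \<comment> \<open>If \<open>r < l\<close>, then \<open>l - r\<close> negates the weight;
      otherwise \<open>r - l\<close> does. Both are smaller than \<open>l\<close>.\<close>
    show False
    proof (cases "r < l")
      case True
      have "f l = w ^\<^sub>m (l - r) *\<^sub>v f r" using add[of "l - r" r] True by simp
      hence "f (l - r) = - eps n i" using fr fl by (simp add: f_def)
      thus False using least[of "l - r"] r True by simp
    next
      case False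
      have "f r = w ^\<^sub>m (r - l) *\<^sub>v f l" using add[of "r - l" l] False by simp
      hence "f (r - l) = - eps n i" using fr fl neg[of "r - l"] by simp
      thus False using least[of "r - l"] r by simp
    qed
  qed
  thus ?thesis using l0 fl by (auto simp: f_def)
qed

text \<open>\<open>h\<close> exchanges the lines of a dual pair, scaling by two factors. Invariance
  of the form on this pair, together with skew-symmetry, forces the product of the factors to be
  -1.\<close>

lemma lifts_uminus_square:
  fixes h :: "'k::field mat"
  assumes h: "h \<in> carrier (Sp ty n)" and li: "lifts n h v" and i: "i < 2 * n"
    and v: "v \<in> carrier_mat n n" "v *\<^sub>v eps n i = - eps n i"
  shows "h *\<^sub>v (h *\<^sub>v unit_vec (2 * n) i) = - unit_vec (2 * n) i"
proof -
  have hc: "h \<in> carrier_mat (2 * n) (2 * n)" using h by (rule Sp_carrierD)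
  let ?j = "opp n i"
  have vi: "v *\<^sub>v eps n i = eps n ?j" using v i by (simp add: eps_opp)
  have vj: "v *\<^sub>v eps n ?j = eps n i"
    using v i by (simp add: eps_opp mult_mat_vec_uminus[OF v(1)])
  have hi: "h $$ (k, i) = 0" if "k < 2 * n" "k \<noteq> ?j" for k
    using li vi i that unfolding lifts_def by (metis eps_inj opp_less)
  have hj: "h $$ (k, ?j) = 0" if "k < 2 * n" "k \<noteq> i" for k
    using li vj i that unfolding lifts_def by (metis eps_inj opp_less)
  have "h *\<^sub>v unit_vec (2 * n) i = h $$ (?j, i) \<cdot>\<^sub>v unit_vec (2 * n) ?j"
    using hc i by (intro eq_vecI) (auto simp: hi)
  moreover have "h *\<^sub>v unit_vec (2 * n) ?j = h $$ (i, ?j) \<cdot>\<^sub>v unit_vec (2 * n) i"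
    using hc i by (intro eq_vecI) (auto simp: hj)
  \<comment> \<open>Evaluate the form on columns \<open>i\<close> and \<open>?j\<close>; the signs
    attached to an index and its opposite differ.\<close>
  moreover have "h $$ (?j, i) * h $$ (i, ?j) = - 1"
  proof -
    have "sgn_form n i = (\<Sum>k<2*n. h $$ (k, i) * sgn_form n k * h $$ (opp n k, ?j))"
      using h i unfolding Sp_entries_iff[OF hc] by auto
    also have "\<dots> = (\<Sum>k<2*n. if k = ?j then h $$ (?j, i) * sgn_form n ?j * h $$ (i, ?j) else 0)"
      using i by (intro sum.cong) (auto simp: hi)
    also have "\<dots> = h $$ (?j, i) * sgn_form n ?j * h $$ (i, ?j)" using i by simp
    finally show ?thesis using opp_lt_iff[OF i] by (auto split: if_splits simp: minus_equation_iff)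
  qed
  ultimately show ?thesis
    using hc i by (simp add: mult_mat_vec[of _ "2 * n" "2 * n"] smult_smult_assoc)
      (intro eq_vecI; simp)
qed

text \<open>With \<open>l\<close> the least negating exponent, the assumption on
  \<open>2 * e\<close> gives \<open>e = l * q\<close>. Every \<open>l\<close> steps of
  \<open>w\<close> negate the weight and every \<open>2 * l\<close> steps of \<open>g\<close> negate
  the basis vector, so both signs are (-1)^q.\<close>

lemma lifts_half_period:
  fixes g :: "'k::field mat"
  assumes g: "g \<in> carrier (Sp ty n)" and li: "lifts n g w" and i: "i < 2 * n"
    and w: "w \<in> carrier_mat n n"
    and ex: "\<exists>m. w ^\<^sub>m m *\<^sub>v eps n i = - eps n i" and we: "w ^\<^sub>m (2 * e) = 1\<^sub>m n"
  shows "(w ^\<^sub>m e *\<^sub>v eps n i = eps n i \<and> g ^\<^sub>m (2 * e) *\<^sub>v unit_vec (2 * n) i = unit_vec (2 * n) i) \<or>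
    (w ^\<^sub>m e *\<^sub>v eps n i = - eps n i \<and> g ^\<^sub>m (2 * e) *\<^sub>v unit_vec (2 * n) i = - unit_vec (2 * n) i)"
proof -
  let ?u = "unit_vec (2 * n) i :: 'k vec"
  have gc: "g \<in> carrier_mat (2 * n) (2 * n)" using g by (rule Sp_carrierD)
  obtain l where l: "w ^\<^sub>m l *\<^sub>v eps n i = - eps n i"
    "\<And>k. w ^\<^sub>m k *\<^sub>v eps n i = eps n i \<Longrightarrow> 2 * l dvd k"
    using least_uminus_period[OF w i ex] by blast
  have "g ^\<^sub>m l \<in> carrier (Sp ty n)"
    using Sp_pow[OF g, of l] monoid.nat_pow_closed[OF group.is_monoid[OF Sp_group] g, of l] by simp
  hence "g ^\<^sub>m l *\<^sub>v (g ^\<^sub>m l *\<^sub>v ?u) = - ?u"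
    by (rule lifts_uminus_square[OF _ lifts_pow[OF gc w li] i pow_carrier_mat[OF w] l(1)])
  hence gl: "g ^\<^sub>m (2 * l) *\<^sub>v ?u = - ?u"
    using pow_mat_mult_vec_add[OF gc, of ?u l l] by (simp add: mult_2)
  have "2 * l dvd 2 * e" using we by (intro l(2)) simp
  then obtain q where q: "e = l * q" by (auto simp: dvd_def)
  show ?thesis unfolding q
  proof (induction q)
    case 0
    show ?case using w gc by simp
  next
    case (Suc q)
    have 1: "w ^\<^sub>m (l * Suc q) *\<^sub>v eps n i = w ^\<^sub>m (l * q) *\<^sub>v (- eps n i)"
      using pow_mat_mult_vec_add[OF w, of "eps n i" "l * q" l] l(1) by (simp add: add.commute)
    have 2: "g ^\<^sub>m (2 * (l * Suc q)) *\<^sub>v ?u = g ^\<^sub>m (2 * (l * q)) *\<^sub>v (- ?u)"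
      using pow_mat_mult_vec_add[OF gc, of ?u "2 * (l * q)" "2 * l"] gl
      by (simp add: add.commute distrib_left)
    show ?case using Suc
      unfolding 1 2 mult_mat_vec_uminus[OF pow_carrier_mat[OF w] eps_carrier(1)]
        mult_mat_vec_uminus[OF pow_carrier_mat[OF gc] unit_vec_carrier] by auto
  qed
qed

subsection \<open>Representatives in the symplectic group and its adjoint quotient\<close>

lemma (in group) conj_eq_iff:
  assumes "g \<in> carrier G" "t \<in> carrier G" "s \<in> carrier G"
  shows "inv g \<otimes> t \<otimes> g = s \<longleftrightarrow> t \<otimes> g = g \<otimes> s"
  using assms inv_solve_left[of s g "t \<otimes> g"] by (auto simp: m_assoc)

text \<open>The two clauses are the two inclusions between \<open>T\<close> and its conjugate by
  \<open>g\<close>, written without inverses so that they become matrix equations.\<close>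

lemma (in group) normalizer_iff:
  assumes T: "T \<subseteq> carrier G"
  shows "g \<in> normalizer G T \<longleftrightarrow> g \<in> carrier G \<and>
    (\<forall>t\<in>T. \<exists>s\<in>T. t \<otimes> g = g \<otimes> s) \<and> (\<forall>t\<in>T. \<exists>s\<in>T. s \<otimes> g = g \<otimes> t)"
proof -
  have eq: "g <# T #> inv g = (\<lambda>t. g \<otimes> t \<otimes> inv g) ` T" for g
    by (auto simp: l_coset_def r_coset_def)
  have conj: "g \<otimes> t \<otimes> inv g = s \<longleftrightarrow> s \<otimes> g = g \<otimes> t"
    if "g \<in> carrier G" "t \<in> T" "s \<in> T" for g t s
  proof -
    have "t \<in> carrier G" "s \<in> carrier G" using that T by auto
    thus ?thesis using that inv_solve_right[of s "g \<otimes> t" g] by auto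
  qed
  have "(\<lambda>t. g \<otimes> t \<otimes> inv g) ` T = T \<longleftrightarrow>
    (\<forall>t\<in>T. \<exists>s\<in>T. t \<otimes> g = g \<otimes> s) \<and> (\<forall>t\<in>T. \<exists>s\<in>T. s \<otimes> g = g \<otimes> t)"
    if g: "g \<in> carrier G"
  proof -
    have "f ` T = T \<longleftrightarrow> (\<forall>s\<in>T. \<exists>t\<in>T. f t = s) \<and> (\<forall>t\<in>T. \<exists>s\<in>T. f t = s)"
      for f :: "'a \<Rightarrow> 'a"
      unfolding set_eq_subset image_subset_iff by (auto simp: subset_iff image_iff; metis)
    from this[of "\<lambda>t. g \<otimes> t \<otimes> inv g"]
    have "(\<lambda>t. g \<otimes> t \<otimes> inv g) ` T = T \<longleftrightarrow>
       (\<forall>s\<in>T. \<exists>t\<in>T. g \<otimes> t \<otimes> inv g = s) \<and> (\<forall>t\<in>T. \<exists>s\<in>T. g \<otimes> t \<otimes> inv g = s)" .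
    thus ?thesis using conj[OF g] by (metis (no_types, lifting))
  qed
  thus ?thesis unfolding normalizer_def stabilizer_def using T eq by auto
qed

lemma Sp_torus_carrier: "t \<in> Sp_torus ty n \<Longrightarrow> t \<in> carrier (Sp ty n)"
  by (simp add: Sp_torus_def)

lemma signed_perm_add_weights:
  assumes w: "signed_perm n w" and ij: "i < 2 * n" "j < 2 * n"
  shows "\<exists>k l. k < 2 * n \<and> l < 2 * n \<and> w *\<^sub>v (eps n i + eps n j) = eps n k + eps n l"
proof -
  have wc: "w \<in> carrier_mat n n" using w by (simp add: signed_perm_def)
  obtain k l where "k < 2 * n" "w *\<^sub>v eps n i = eps n k" "l < 2 * n" "w *\<^sub>v eps n j = eps n l"
    using w ij unfolding signed_perm_def by blast
  thus ?thesis using wc by (intro exI[of _ k] exI[of _ l]) (simp add: mult_add_distrib_mat_vec[OF wc])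
qed

text \<open>The element \<open>s\<close> supplied by the normalizer is the conjugate of
  \<open>t\<close> by the inverse of \<open>g\<close>, so the defining condition on characters is
  the hypothesis of \<open>lifts_of_char\<close>.\<close>

lemma Sp_reps_lifts:
  fixes g :: "'k::alg_closed_field mat"
  assumes w: "signed_perm n w" and g: "g \<in> Sp_reps ty n w"
  shows "g \<in> carrier (Sp ty n)" "lifts n g w"
proof -
  interpret group "Sp ty n" by (rule Sp_group)
  have T: "Sp_torus ty n \<subseteq> carrier (Sp ty n)" using Sp_torus_carrier by blast
  have N: "g \<in> normalizer (Sp ty n) (Sp_torus ty n)"
    and ch: "\<And>\<alpha> t. \<alpha> \<in> roots_C n \<Longrightarrow> t \<in> Sp_torus ty n \<Longrightarrow>
      Sp_char n \<alpha> (inv\<^bsub>Sp ty n\<^esub> g * t * g) = Sp_char n (w *\<^sub>v \<alpha>) t"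
    using g by (auto simp: Sp_reps_def weyl_reps_def)
  show gc: "g \<in> carrier (Sp ty n)" using N normalizer_iff[OF T] by blast
  show "lifts n g w"
  proof (rule lifts_of_char[OF w Sp_carrierD[OF gc]])
    fix t assume t: "t \<in> Sp_torus ty n"
    obtain s where s: "s \<in> Sp_torus ty n" "t * g = g * s" using N t normalizer_iff[OF T] by auto
    have "inv\<^bsub>Sp ty n\<^esub> g * t * g = s" using conj_eq_iff[OF gc, of t s] s t T by auto
    thus "\<exists>s\<in>Sp_torus ty n. t * g = g * s \<and>
        (\<forall>\<alpha>\<in>roots_C n. Sp_char n \<alpha> s = Sp_char n (w *\<^sub>v \<alpha>) t)"
      using s ch t by (intro bexI[of _ s]) auto
  qed
qed

section \<open>The central subgroup of order at most two and the adjoint quotient\<close>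

lemma uminus_one_mult_mat [simp]:
  fixes A :: "'a::comm_ring_1 mat"
  assumes "A \<in> carrier_mat n m"
  shows "- 1\<^sub>m n * A = - A" "A * - 1\<^sub>m m = - A"
  using assms by auto

lemma Sp_centre_normal: "Sp_centre (ty :: 'k::field itself) n \<lhd> Sp ty n"
proof -
  interpret group "Sp ty n" by (rule Sp_group)
  let ?I = "1\<^sub>m (2 * n) :: 'k mat"
  have c: "- ?I \<in> carrier (Sp ty n)"
    by (rule Sp_torus_carrier) (auto simp: Sp_torus_iff diagonal_mat_def)
  have one: "?I \<in> carrier (Sp ty n)" using one_closed by simp
  have sq: "- ?I * - ?I = ?I" by simp
  have "inv\<^bsub>Sp ty n\<^esub> (- ?I) = - ?I" using inv_equality[of "- ?I" "- ?I"] c sq by simp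
  moreover have "inv\<^bsub>Sp ty n\<^esub> ?I = ?I" using inv_one by simp
  ultimately have sub: "subgroup (Sp_centre ty n) (Sp ty n)"
    using c one sq by (intro subgroupI) (auto simp: Sp_centre_def)
  show ?thesis
    unfolding normal_inv_iff
  proof (intro conjI ballI sub)
    fix x h assume x: "x \<in> carrier (Sp ty n)" and h: "h \<in> Sp_centre ty n"
    have xi: "x * inv\<^bsub>Sp ty n\<^esub> x = ?I" using r_inv[OF x] by simp
    have "x * h = h * x" using Sp_carrierD[OF x] h by (auto simp: Sp_centre_def)
    hence "x * h * inv\<^bsub>Sp ty n\<^esub> x = h * (x * inv\<^bsub>Sp ty n\<^esub> x)"
      using Sp_carrierD[OF x] Sp_carrierD[OF inv_closed[OF x]] h
      by (subst assoc_mult_mat[symmetric, of _ "2*n" "2*n" _ "2*n" _ "2*n"]) (auto simp: Sp_centre_def)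
    thus "x \<otimes>\<^bsub>Sp ty n\<^esub> h \<otimes>\<^bsub>Sp ty n\<^esub> inv\<^bsub>Sp ty n\<^esub> x \<in> Sp_centre ty n"
      using xi h by (auto simp: Sp_centre_def)
  qed
qed

lemma Sp_centre_coset:
  assumes "g \<in> carrier_mat (2 * n) (2 * n)"
  shows "Sp_centre ty n #>\<^bsub>Sp ty n\<^esub> g = {g, - g}"
  using assms by (auto simp: r_coset_def Sp_centre_def)

lemma Sp_torus_uminus:
  assumes "t \<in> Sp_torus ty n"
  shows "- t \<in> Sp_torus ty n"
  using assms by (auto simp: Sp_torus_iff diagonal_mat_def)

text \<open>A root value is a product of two diagonal entries, so the sign of the coset
  representative cancels and \<open>the_elem\<close> is applied to a singleton.\<close>

lemma PSp_char_coset: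
  fixes t :: "'k::field mat"
  assumes t: "t \<in> Sp_torus ty n" and ij: "i < 2 * n" "j < 2 * n"
  shows "PSp_char n (eps n i + eps n j) (Sp_centre ty n #>\<^bsub>Sp ty n\<^esub> t) =
    Sp_char n (eps n i + eps n j) t"
proof -
  have tc: "t \<in> carrier_mat (2 * n) (2 * n)" using t by (simp add: Sp_torus_iff)
  have "Sp_char n (eps n i + eps n j) (- t) = Sp_char n (eps n i + eps n j) t"
    unfolding Sp_char_eps[OF t ij] Sp_char_eps[OF Sp_torus_uminus[OF t] ij] using tc ij by simp
  thus ?thesis unfolding PSp_char_def Sp_centre_coset[OF tc] by simp
qed

lemma PSp_group: "group (PSp ty n)"
  unfolding PSp_def by (rule normal.factorgroup_is_group[OF Sp_centre_normal])

lemma PSp_carrier: "carrier (PSp ty n) = (\<lambda>g. Sp_centre ty n #>\<^bsub>Sp ty n\<^esub> g) ` carrier (Sp ty n)"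
  unfolding PSp_def by (rule carrier_FactGroup)

lemma PSp_mult:
  assumes "g \<in> carrier (Sp ty n)" "h \<in> carrier (Sp ty n)"
  shows "(Sp_centre ty n #>\<^bsub>Sp ty n\<^esub> g) \<otimes>\<^bsub>PSp ty n\<^esub> (Sp_centre ty n #>\<^bsub>Sp ty n\<^esub> h) =
    Sp_centre ty n #>\<^bsub>Sp ty n\<^esub> (g * h)"
  unfolding PSp_def using normal.rcos_sum[OF Sp_centre_normal assms] by simp

lemma PSp_torus_carrier: "PSp_torus ty n \<subseteq> carrier (PSp ty n)"
  unfolding PSp_torus_def PSp_carrier using Sp_torus_carrier by blast

lemma PSp_pow_eq_one_iff:
  assumes g: "g \<in> carrier (Sp ty n)"
  shows "(Sp_centre ty n #>\<^bsub>Sp ty n\<^esub> g) [^]\<^bsub>PSp ty n\<^esub> (m::nat) = \<one>\<^bsub>PSp ty n\<^esub> \<longleftrightarrow>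
    g ^\<^sub>m m \<in> Sp_centre ty n"
proof -
  interpret normal "Sp_centre ty n" "Sp ty n" by (rule Sp_centre_normal)
  have c: "g ^\<^sub>m m \<in> carrier (Sp ty n)" using nat_pow_closed[OF g, of m] by (simp add: Sp_pow[OF g])
  have "(Sp_centre ty n #>\<^bsub>Sp ty n\<^esub> g) [^]\<^bsub>PSp ty n\<^esub> m = Sp_centre ty n #>\<^bsub>Sp ty n\<^esub> (g ^\<^sub>m m)"
    unfolding PSp_def FactGroup_pow[OF g] Sp_pow[OF g] ..
  moreover have "\<one>\<^bsub>PSp ty n\<^esub> = Sp_centre ty n" by (simp add: PSp_def)
  ultimately show ?thesis
    using c coset_join1[OF _ c subgroup_axioms] coset_join2[OF c subgroup_axioms] by auto
qed

text \<open>An equation between cosets is one between matrices up to sign, and the sign can be moved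
  into the torus element without changing its coset. This reduces the claim to
  \<open>lifts_of_char\<close>.\<close>

lemma PSp_reps_lifts:
  fixes X :: "'k::alg_closed_field mat set"
  assumes w: "signed_perm n w" and X: "X \<in> PSp_reps ty n w"
  shows "\<exists>g\<in>carrier (Sp ty n). lifts n g w \<and> X = Sp_centre ty n #>\<^bsub>Sp ty n\<^esub> g"
proof -
  interpret P: group "PSp ty n" by (rule PSp_group)
  interpret Sp: group "Sp ty n" by (rule Sp_group)
  let ?Z = "\<lambda>g. Sp_centre ty n #>\<^bsub>Sp ty n\<^esub> g"
  have N: "X \<in> normalizer (PSp ty n) (PSp_torus ty n)"
    and ch: "\<And>\<alpha> t. \<alpha> \<in> roots_C n \<Longrightarrow> t \<in> PSp_torus ty n \<Longrightarrow>
      PSp_char n \<alpha> (inv\<^bsub>PSp ty n\<^esub> X \<otimes>\<^bsub>PSp ty n\<^esub> t \<otimes>\<^bsub>PSp ty n\<^esub> X) = PSp_char n (w *\<^sub>v \<alpha>) t"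
    using X by (auto simp: PSp_reps_def weyl_reps_def)
  have Xc: "X \<in> carrier (PSp ty n)" using N P.normalizer_iff[OF PSp_torus_carrier] by blast
  then obtain g where g: "g \<in> carrier (Sp ty n)" "X = ?Z g" unfolding PSp_carrier by blast
  have gm: "g \<in> carrier_mat (2 * n) (2 * n)" by (rule Sp_carrierD[OF g(1)])
  have "lifts n g w"
  proof (rule lifts_of_char[OF w gm])
    fix t assume t: "t \<in> Sp_torus ty n"
    hence tP: "?Z t \<in> PSp_torus ty n" by (simp add: PSp_torus_def)
    obtain S where S: "S \<in> PSp_torus ty n" "?Z t \<otimes>\<^bsub>PSp ty n\<^esub> X = X \<otimes>\<^bsub>PSp ty n\<^esub> S"
      using N tP P.normalizer_iff[OF PSp_torus_carrier] by blast
    then obtain s' where s': "s' \<in> Sp_torus ty n" "S = ?Z s'" by (auto simp: PSp_torus_def)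
    note tc = Sp_torus_carrier[OF t] and sc' = Sp_torus_carrier[OF s'(1)]
    have "?Z (t * g) = ?Z (g * s')"
      using S(2) PSp_mult[OF tc g(1)] PSp_mult[OF g(1) sc'] by (simp add: g(2) s'(2))
    hence "{t * g, - (t * g)} = {g * s', - (g * s')}"
      using Sp_centre_coset[of "t * g" n ty] Sp_centre_coset[of "g * s'" n ty] gm Sp_carrierD[OF tc] Sp_carrierD[OF sc']
      by (simp add: mult_carrier_mat[of _ _ "2 * n"])
    hence "t * g = g * s' \<or> t * g = g * - s'"
      using gm Sp_carrierD[OF sc'] by auto
    then obtain s where s: "s \<in> Sp_torus ty n" "t * g = g * s" "S = ?Z s"
    proof
      assume "t * g = g * - s'"
      moreover have "S = ?Z (- s')"
        unfolding s'(2) using Sp_centre_coset[of s' n ty] Sp_centre_coset[of "- s'" n ty] Sp_carrierD[OF sc']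
        by auto
      ultimately show thesis using Sp_torus_uminus[OF s'(1)] that by blast
    qed (use s' in blast)
    have inv: "inv\<^bsub>PSp ty n\<^esub> X \<otimes>\<^bsub>PSp ty n\<^esub> ?Z t \<otimes>\<^bsub>PSp ty n\<^esub> X = ?Z s"
      using P.conj_eq_iff[OF Xc, of "?Z t" S] S tP PSp_torus_carrier s(3) by blast
    have "Sp_char n \<alpha> s = Sp_char n (w *\<^sub>v \<alpha>) t" if \<alpha>: "\<alpha> \<in> roots_C n" for \<alpha>
    proof -
      obtain i j where ij: "i < 2 * n" "j < 2 * n" "\<alpha> = eps n i + eps n j"
        using \<alpha> unfolding roots_C_iff by blast
      obtain k l where kl: "k < 2 * n" "l < 2 * n" "w *\<^sub>v \<alpha> = eps n k + eps n l"
        using signed_perm_add_weights[OF w ij(1,2)] ij by auto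
      show ?thesis using ch[OF \<alpha> tP] unfolding inv kl(3)
        unfolding ij(3) PSp_char_coset[OF s(1) ij(1,2)] PSp_char_coset[OF t kl(1,2)] .
    qed
    thus "\<exists>s\<in>Sp_torus ty n. t * g = g * s \<and>
        (\<forall>\<alpha>\<in>roots_C n. Sp_char n \<alpha> s = Sp_char n (w *\<^sub>v \<alpha>) t)"
      using s by blast
  qed
  thus ?thesis using g by blast
qed

text \<open>The signs are forced by the form: a basis vector of the first half keeps its coefficient, one
  of the second half changes sign exactly when it is moved to the first half.\<close>

lemma ex_torus_normalizing_lift:
  fixes ty :: "'k::field itself"
  assumes w: "signed_perm n w" and inj: "\<And>u v. u \<in> carrier_vec n \<Longrightarrow> v \<in> carrier_vec n \<Longrightarrow>
      w *\<^sub>v u = w *\<^sub>v v \<Longrightarrow> u = v"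
  shows "\<exists>g\<in>carrier (Sp ty n).
    (\<forall>t\<in>Sp_torus ty n. \<exists>s\<in>Sp_torus ty n. t * g = g * s \<and>
      (\<forall>\<alpha>\<in>roots_C n. Sp_char n \<alpha> s = Sp_char n (w *\<^sub>v \<alpha>) t)) \<and>
    (\<forall>t\<in>Sp_torus ty n. \<exists>s\<in>Sp_torus ty n. s * g = g * t)"
proof -
  have wc: "w \<in> carrier_mat n n" using w by (simp add: signed_perm_def)
  obtain \<sigma> where \<sigma>: "\<And>i. i < 2 * n \<Longrightarrow> \<sigma> i < 2 * n" "\<And>i. i < 2 * n \<Longrightarrow> w *\<^sub>v eps n i = eps n (\<sigma> i)"
    using w unfolding signed_perm_def by metis
  have \<sigma>_inj: "\<sigma> i = \<sigma> j \<longleftrightarrow> i = j" if "i < 2 * n" "j < 2 * n" for i j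
    using inj[of "eps n i" "eps n j"] \<sigma> that by (metis eps_carrier(1) eps_inj)
  \<comment> \<open>By linearity, \<open>w\<close> sends opposite weights to opposite
    weights.\<close>
  have \<sigma>_opp: "\<sigma> (opp n i) = opp n (\<sigma> i)" if "i < 2 * n" for i
  proof -
    have "eps n (\<sigma> (opp n i)) = eps n (opp n (\<sigma> i))"
      using that \<sigma> \<sigma>(2)[of "opp n i"] by (simp add: eps_opp mult_mat_vec_uminus[OF wc])
    thus ?thesis using that \<sigma> by (simp add: eps_inj)
  qed
  have bij: "bij_betw \<sigma> {..<2*n} {..<2*n}"
    unfolding bij_betw_def
  proof
    show "inj_on \<sigma> {..<2*n}" using \<sigma>_inj by (simp add: inj_on_def)
    thus "\<sigma> ` {..<2*n} = {..<2*n}" using \<sigma>(1) by (intro endo_inj_surj) auto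
  qed
  define \<tau> where "\<tau> = inv_into {..<2*n} \<sigma>"
  have \<tau>: "\<tau> k < 2 * n" "\<sigma> (\<tau> k) = k" if "k < 2 * n" for k
    using bij_betw_inv_into_right[OF bij, of k] bij_betw_apply[OF bij_betw_inv_into[OF bij], of k] that
    by (auto simp: \<tau>_def)
  have \<tau>\<sigma>: "\<tau> (\<sigma> i) = i" if "i < 2 * n" for i
    using bij_betw_inv_into_left[OF bij, of i] that by (simp add: \<tau>_def)
  have \<tau>_opp: "\<tau> (opp n k) = opp n (\<tau> k)" if "k < 2 * n" for k
    using \<tau>[OF that] \<sigma>_opp[of "\<tau> k"] \<tau>\<sigma>[of "opp n (\<tau> k)"] by simp
  define c :: "nat \<Rightarrow> 'k" where "c i = (if \<not> i < n \<and> \<sigma> i < n then - 1 else 1)" for i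
  define g where "g = mat (2 * n) (2 * n) (\<lambda>(k, i). if k = \<sigma> i then c i else 0)"
  have gc: "g \<in> carrier_mat (2 * n) (2 * n)" by (simp add: g_def)
  have gS: "g \<in> carrier (Sp ty n)"
    unfolding Sp_entries_iff[OF gc]
  proof (intro allI impI)
    fix i j assume ij: "i < 2 * n" "j < 2 * n"
    have "(\<Sum>k<2*n. g $$ (k, i) * sgn_form n k * g $$ (opp n k, j)) =
      (\<Sum>k<2*n. if k = \<sigma> i then c i * sgn_form n (\<sigma> i) * g $$ (opp n (\<sigma> i), j) else 0)"
      using ij by (intro sum.cong) (auto simp: g_def)
    also have "\<dots> = c i * sgn_form n (\<sigma> i) * g $$ (\<sigma> (opp n i), j)"
      using \<sigma>(1)[OF ij(1)] \<sigma>_opp[OF ij(1)] by simp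
    also have "\<dots> = (if j = opp n i then c i * sgn_form n (\<sigma> i) * c (opp n i) else 0)"
      using ij \<sigma>(1)[of "opp n i"] \<sigma>_inj[of "opp n i" j] by (auto simp: g_def)
    also have "c i * sgn_form n (\<sigma> i) * c (opp n i) = (sgn_form n i :: 'k)"
      using ij \<sigma>(1)[OF ij(1)] \<sigma>_opp[OF ij(1)] opp_lt_iff[of i n] opp_lt_iff[of "\<sigma> i" n] by (auto simp: c_def)
    finally show "(\<Sum>k<2*n. g $$ (k, i) * sgn_form n k * g $$ (opp n k, j)) =
      (if j = opp n i then sgn_form n i else 0)" .
  qed
  \<comment> \<open>Permuting the diagonal of \<open>t\<close>: with \<sigma> this is the conjugate
    by the inverse of \<open>g\<close>, with \<tau> the conjugate by \<open>g\<close>. Compatibility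
    with \<open>opp\<close> keeps it in the torus.\<close>
  define conj where "conj \<rho> t = mat (2 * n) (2 * n) (\<lambda>(a, b). if a = b then t $$ (\<rho> a, \<rho> a) else 0)"
    for \<rho> :: "nat \<Rightarrow> nat" and t :: "'k mat"
  have conj: "conj \<rho> t \<in> Sp_torus ty n"
    if "t \<in> Sp_torus ty n" and \<rho>: "\<And>i. i < 2 * n \<Longrightarrow> \<rho> i < 2 * n" "\<And>i. i < 2 * n \<Longrightarrow> \<rho> (opp n i) = opp n (\<rho> i)"
    for \<rho> t
    using that by (auto simp: Sp_torus_iff conj_def diagonal_mat_def)
  have prod_eq: "t * g = g * s"
    if "t \<in> Sp_torus ty n" "s \<in> Sp_torus ty n" "\<And>i. i < 2 * n \<Longrightarrow> t $$ (\<sigma> i, \<sigma> i) = s $$ (i, i)" for t s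
  proof (rule eq_matI)
    fix k i assume "k < dim_row (g * s)" "i < dim_col (g * s)"
    hence ki: "k < 2 * n" "i < 2 * n" using that by (auto simp: g_def Sp_torus_iff)
    have td: "t \<in> carrier_mat (2 * n) (2 * n)" "diagonal_mat t"
      and sd: "s \<in> carrier_mat (2 * n) (2 * n)" "diagonal_mat s"
      using that by (auto simp: Sp_torus_iff)
    show "(t * g) $$ (k, i) = (g * s) $$ (k, i)"
      unfolding diagonal_mult_index(1)[OF td gc ki] diagonal_mult_index(2)[OF sd gc ki]
      using ki that(3)[of i] by (auto simp: g_def)
  qed (use that in \<open>auto simp: g_def Sp_torus_iff\<close>)
  show ?thesis
  proof (intro bexI[OF _ gS] conjI ballI)
    fix t assume t: "t \<in> Sp_torus ty n"
    have s: "conj \<sigma> t \<in> Sp_torus ty n"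
      by (rule conj[OF t]) (simp_all add: \<sigma>(1) \<sigma>_opp)
    have "Sp_char n \<alpha> (conj \<sigma> t) = Sp_char n (w *\<^sub>v \<alpha>) t" if "\<alpha> \<in> roots_C n" for \<alpha>
    proof -
      obtain i j where ij: "i < 2 * n" "j < 2 * n" "\<alpha> = eps n i + eps n j"
        using \<open>\<alpha> \<in> roots_C n\<close> unfolding roots_C_iff by blast
      have "w *\<^sub>v \<alpha> = eps n (\<sigma> i) + eps n (\<sigma> j)"
        using ij \<sigma> by (simp add: mult_add_distrib_mat_vec[OF wc])
      thus ?thesis
        using Sp_char_eps[OF s ij(1,2)] Sp_char_eps[OF t \<sigma>(1)[OF ij(1)] \<sigma>(1)[OF ij(2)]] ij
        by (simp add: conj_def)
    qed
    moreover have "t * g = g * conj \<sigma> t"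
      by (rule prod_eq[OF t s]) (simp add: conj_def)
    ultimately show "\<exists>s\<in>Sp_torus ty n. t * g = g * s \<and>
      (\<forall>\<alpha>\<in>roots_C n. Sp_char n \<alpha> s = Sp_char n (w *\<^sub>v \<alpha>) t)" using s by blast
  next
    fix t assume t: "t \<in> Sp_torus ty n"
    have s: "conj \<tau> t \<in> Sp_torus ty n"
      by (rule conj[OF t]) (simp_all add: \<tau>(1) \<tau>_opp)
    have "conj \<tau> t * g = g * t"
      by (rule prod_eq[OF s t]) (simp add: conj_def \<sigma>(1) \<tau>\<sigma>)
    thus "\<exists>s\<in>Sp_torus ty n. s * g = g * t" using s by blast
  qed
qed

text \<open>Spin quantifies over all representatives, so adjoint spin 1 would hold vacuously if
  there were none. A representative is needed to extract information from it.\<close>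

lemma PSp_reps_nonempty:
  fixes ty :: "'k::field itself"
  assumes w: "w \<in> carrier (weyl_C n)"
  shows "PSp_reps ty n w \<noteq> {}"
proof -
  interpret P: group "PSp ty n" by (rule PSp_group)
  let ?Z = "\<lambda>g. Sp_centre ty n #>\<^bsub>Sp ty n\<^esub> g"
  have sp: "signed_perm n w" by (rule weyl_C_carrierD[OF w])
  have "w \<in> carrier (GL TYPE(real) n)"
    using w subgroup.subset[OF weyl_C_subgroup, of n] by (auto simp: weyl_C_def)
  note iw = GL_inv[OF this] GL_carrierD[OF this]
  have inj: "u = v" if uv: "u \<in> carrier_vec n" "v \<in> carrier_vec n" "w *\<^sub>v u = w *\<^sub>v v" for u v
  proof -
    have "inv\<^bsub>GL TYPE(real) n\<^esub> w *\<^sub>v (w *\<^sub>v x) = x" if "x \<in> carrier_vec n" for x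
      using assoc_mult_mat_vec[OF GL_carrierD[OF iw(1)] iw(4) that] iw(3) that by simp
    thus ?thesis using uv by metis
  qed
  obtain g where g: "g \<in> carrier (Sp ty n)"
    and N1: "\<And>t. t \<in> Sp_torus ty n \<Longrightarrow> \<exists>s\<in>Sp_torus ty n. t * g = g * s \<and>
      (\<forall>\<alpha>\<in>roots_C n. Sp_char n \<alpha> s = Sp_char n (w *\<^sub>v \<alpha>) t)"
    and N2: "\<And>t. t \<in> Sp_torus ty n \<Longrightarrow> \<exists>s\<in>Sp_torus ty n. s * g = g * t"
    using ex_torus_normalizing_lift[OF sp inj, of ty] by blast
  have Xc: "?Z g \<in> carrier (PSp ty n)" using g by (auto simp: PSp_carrier)
  have PT: "?Z t \<in> PSp_torus ty n" if "t \<in> Sp_torus ty n" for t using that by (simp add: PSp_torus_def)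
  have eq: "?Z t \<otimes>\<^bsub>PSp ty n\<^esub> ?Z g = ?Z g \<otimes>\<^bsub>PSp ty n\<^esub> ?Z s"
    if "t \<in> Sp_torus ty n" "s \<in> Sp_torus ty n" "t * g = g * s" for t s
    unfolding PSp_mult[OF Sp_torus_carrier[OF that(1)] g] PSp_mult[OF g Sp_torus_carrier[OF that(2)]] that(3) ..
  have "?Z g \<in> PSp_reps ty n w"
    unfolding PSp_reps_def weyl_reps_def P.normalizer_iff[OF PSp_torus_carrier]
  proof (intro CollectI conjI Xc ballI)
    fix S assume "S \<in> PSp_torus ty n"
    then obtain t where t: "t \<in> Sp_torus ty n" "S = ?Z t" by (auto simp: PSp_torus_def)
    show "\<exists>s\<in>PSp_torus ty n. S \<otimes>\<^bsub>PSp ty n\<^esub> ?Z g = ?Z g \<otimes>\<^bsub>PSp ty n\<^esub> s"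
      using N1[OF t(1)] PT eq t by blast
    show "\<exists>s\<in>PSp_torus ty n. s \<otimes>\<^bsub>PSp ty n\<^esub> ?Z g = ?Z g \<otimes>\<^bsub>PSp ty n\<^esub> S"
      using N2[OF t(1)] PT eq t by blast
  next
    fix \<alpha> S assume \<alpha>: "\<alpha> \<in> roots_C n" and "S \<in> PSp_torus ty n"
    then obtain t where t: "t \<in> Sp_torus ty n" "S = ?Z t" by (auto simp: PSp_torus_def)
    obtain s where s: "s \<in> Sp_torus ty n" "t * g = g * s"
      "Sp_char n \<alpha> s = Sp_char n (w *\<^sub>v \<alpha>) t" using N1[OF t(1)] \<alpha> by blast
    have inv: "inv\<^bsub>PSp ty n\<^esub> ?Z g \<otimes>\<^bsub>PSp ty n\<^esub> S \<otimes>\<^bsub>PSp ty n\<^esub> ?Z g = ?Z s"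
      unfolding t(2)
      using P.conj_eq_iff[OF Xc, of "?Z t" "?Z s"] eq[OF t(1) s(1,2)] PT[OF t(1)] PT[OF s(1)] PSp_torus_carrier
      by blast
    obtain i j where ij: "i < 2 * n" "j < 2 * n" "\<alpha> = eps n i + eps n j"
      using \<alpha> unfolding roots_C_iff by blast
    obtain k l where kl: "k < 2 * n" "l < 2 * n" "w *\<^sub>v \<alpha> = eps n k + eps n l"
      using signed_perm_add_weights[OF sp ij(1,2)] ij by auto
    show "PSp_char n \<alpha> (inv\<^bsub>PSp ty n\<^esub> ?Z g \<otimes>\<^bsub>PSp ty n\<^esub> S \<otimes>\<^bsub>PSp ty n\<^esub> ?Z g) = PSp_char n (w *\<^sub>v \<alpha>) S"
      using s(3) unfolding inv unfolding t(2) kl(3)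
      unfolding ij(3) PSp_char_coset[OF s(1) ij(1,2)] PSp_char_coset[OF t(1) kl(1,2)] .
  qed
  thus ?thesis by blast
qed

subsection \<open>Orders of representatives\<close>

text \<open>A power of \<open>w\<close> equal to -1 squares to the identity without being it; after
  reducing the exponent modulo the order \<open>d\<close>, only \<open>d div 2\<close>
  remains.\<close>

lemma elliptic_weyl_C_facts:
  assumes w: "w \<in> carrier (weyl_C n)" and ell: "elliptic w" and n: "n > 0"
  defines "d \<equiv> group.ord (weyl_C n) w"
  shows "d > 0" "even d" "w ^\<^sub>m m = 1\<^sub>m n \<longleftrightarrow> d dvd m"
    "i < 2 * n \<Longrightarrow> \<exists>m. w ^\<^sub>m m *\<^sub>v eps n i = - eps n i"
    "(\<exists>r::int. w [^]\<^bsub>weyl_C n\<^esub> r = - 1\<^sub>m n) \<longleftrightarrow> w ^\<^sub>m (d div 2) = - 1\<^sub>m n"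
proof -
  interpret W: group "weyl_C n" by (rule weyl_C_group)
  have sp: "signed_perm n w" by (rule weyl_C_carrierD[OF w])
  hence wc: "w \<in> carrier_mat n n" by (simp add: signed_perm_def)
  have one: "\<one>\<^bsub>weyl_C n\<^esub> = 1\<^sub>m n" by (simp add: weyl_C_def)
  show d0: "d > 0" unfolding d_def using W.ord_ge_1[OF weyl_C_finite w] by simp
  show pow: "w ^\<^sub>m m = 1\<^sub>m n \<longleftrightarrow> d dvd m" for m
    unfolding d_def W.pow_eq_id[OF w, symmetric] weyl_C_pow[OF w] one ..
  show neg: "\<exists>m. w ^\<^sub>m m *\<^sub>v eps n i = - eps n i" if "i < 2 * n" for i
    by (rule elliptic_orbit_uminus[OF sp ell d0 _ that]) (simp add: pow)
  have i0: "0 < 2 * n" using n by simp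
  \<comment> \<open>One weight suffices for evenness: its period \<open>2 * l\<close> divides the
    order. It exists because \<open>n > 0\<close>.\<close>
  obtain l where "\<forall>k. w ^\<^sub>m k *\<^sub>v eps n 0 = eps n 0 \<longrightarrow> 2 * l dvd k"
    using least_uminus_period[OF wc i0 neg[OF i0]] by blast
  hence "2 * l dvd d" using pow[of d] by simp
  thus ev: "even d" by (rule dvd_mult_left)
  show "(\<exists>r::int. w [^]\<^bsub>weyl_C n\<^esub> r = - 1\<^sub>m n) \<longleftrightarrow> w ^\<^sub>m (d div 2) = - 1\<^sub>m n"
  proof
    assume "\<exists>r::int. w [^]\<^bsub>weyl_C n\<^esub> r = - 1\<^sub>m n"
    then obtain r :: int where r: "w [^]\<^bsub>weyl_C n\<^esub> r = - 1\<^sub>m n" by blast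
    define k where "k = nat (r mod int d)"
    have k: "int k = r mod int d" "k < d" using d0 by (auto simp: k_def nat_less_iff)
    have "w [^]\<^bsub>weyl_C n\<^esub> int k = w [^]\<^bsub>weyl_C n\<^esub> r"
      unfolding W.int_pow_eq[OF w] k(1) d_def[symmetric] by (simp add: mod_eq_dvd_iff[symmetric])
    hence wk: "w ^\<^sub>m k = - 1\<^sub>m n" using r by (simp add: int_pow_int weyl_C_pow[OF w])
    have "w ^\<^sub>m (k + k) = 1\<^sub>m n"
    proof (rule eps_ext[OF pow_carrier_mat[OF wc] one_carrier_mat])
      fix i assume "i < 2 * n"
      show "w ^\<^sub>m (k + k) *\<^sub>v eps n i = 1\<^sub>m n *\<^sub>v eps n i"
        unfolding pow_mat_mult_vec_add[OF wc eps_carrier(1)] wk by simp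
    qed
    then obtain q where q: "k + k = d * q" using pow by (auto simp: dvd_def)
    have "k \<noteq> 0"
    proof
      assume "k = 0"
      hence "(1\<^sub>m n :: real mat) $$ (0, 0) = (- 1\<^sub>m n) $$ (0, 0)" using wk wc by simp
      thus False using n by simp
    qed
    hence "q \<noteq> 0" using q by (cases q) auto
    moreover have "d * q < d * 2" using k(2) unfolding q[symmetric] by simp
    hence "q < 2" using d0 by simp
    ultimately have "k + k = d" using q by (simp add: less_2_cases_iff)
    hence "k = d div 2" by simp
    thus "w ^\<^sub>m (d div 2) = - 1\<^sub>m n" using wk by simp
  next
    assume "w ^\<^sub>m (d div 2) = - 1\<^sub>m n"
    hence "w [^]\<^bsub>weyl_C n\<^esub> int (d div 2) = - 1\<^sub>m n" by (simp add: int_pow_int weyl_C_pow[OF w])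
    thus "\<exists>r::int. w [^]\<^bsub>weyl_C n\<^esub> r = - 1\<^sub>m n" by blast
  qed
qed

text \<open>The sign comparison of \<open>lifts_half_period\<close> is used with exponent
  \<open>d\<close> and with \<open>d div 2\<close>. The assumption on 1 and -1 separates a basis
  vector from its negative.\<close>

lemma lifts_elliptic_pow:
  fixes g :: "'k::field mat"
  assumes char: "(1::'k) \<noteq> - 1" and n: "n > 0"
    and w: "w \<in> carrier (weyl_C n)" and ell: "elliptic w"
    and g: "g \<in> carrier (Sp ty n)" "lifts n g w"
  defines "d \<equiv> group.ord (weyl_C n) w"
  shows "g ^\<^sub>m m \<in> Sp_centre ty n \<Longrightarrow> d dvd m"
    "g ^\<^sub>m (2 * d) = 1\<^sub>m (2 * n)" "g ^\<^sub>m d \<noteq> 1\<^sub>m (2 * n)"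
    "g ^\<^sub>m d = - 1\<^sub>m (2 * n) \<longleftrightarrow> w ^\<^sub>m (d div 2) = - 1\<^sub>m n"
proof -
  note W = elliptic_weyl_C_facts[OF w ell n, folded d_def]
  let ?u = "\<lambda>i. unit_vec (2 * n) i :: 'k vec"
  have wc: "w \<in> carrier_mat n n" using weyl_C_carrierD[OF w] by (simp add: signed_perm_def)
  have gc: "g \<in> carrier_mat (2 * n) (2 * n)" by (rule Sp_carrierD[OF g(1)])
  have u_neq: "?u i \<noteq> - ?u i" if "i < 2 * n" for i
  proof
    assume "?u i = - ?u i"
    hence "?u i $ i = (- ?u i) $ i" by simp
    thus False using that char by simp
  qed
  have half: "(w ^\<^sub>m e *\<^sub>v eps n i = eps n i \<and> g ^\<^sub>m (2 * e) *\<^sub>v ?u i = ?u i) \<or>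
    (w ^\<^sub>m e *\<^sub>v eps n i = - eps n i \<and> g ^\<^sub>m (2 * e) *\<^sub>v ?u i = - ?u i)"
    if "i < 2 * n" "w ^\<^sub>m (2 * e) = 1\<^sub>m n" for i e
    by (rule lifts_half_period[OF g that(1) wc W(4)[OF that(1)] that(2)])
  define e where "e = d div 2"
  have de: "d = 2 * e" using W(2) by (simp add: e_def)
  have we: "w ^\<^sub>m (2 * e) = 1\<^sub>m n" using W(3) de by simp
  have pw: "w ^\<^sub>m k \<in> carrier_mat n n" for k by (rule pow_carrier_mat[OF wc])
  have pg: "g ^\<^sub>m k \<in> carrier_mat (2 * n) (2 * n)" for k by (rule pow_carrier_mat[OF gc])
  show "d dvd m" if m: "g ^\<^sub>m m \<in> Sp_centre ty n"
    unfolding W(3)[symmetric]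
  proof (rule eps_ext[OF pw one_carrier_mat])
    fix i assume i: "i < 2 * n"
    \<comment> \<open>A central matrix has nonzero diagonal, so its lifting property makes
      \<open>w\<close> to the power \<open>m\<close> fix every weight.\<close>
    have "(g ^\<^sub>m m) $$ (i, i) \<noteq> 0" using m i by (auto simp: Sp_centre_def)
    thus "w ^\<^sub>m m *\<^sub>v eps n i = 1\<^sub>m n *\<^sub>v eps n i"
      using lifts_pow[OF gc wc g(2), of m] i by (auto simp: lifts_def)
  qed
  show "g ^\<^sub>m (2 * d) = 1\<^sub>m (2 * n)"
  proof (rule mult_mat_vec_ext[OF pg one_carrier_mat])
    fix i assume i: "i < 2 * n"
    have "w ^\<^sub>m d = 1\<^sub>m n" "w ^\<^sub>m (2 * d) = 1\<^sub>m n" by (simp_all add: W(3))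
    thus "g ^\<^sub>m (2 * d) *\<^sub>v ?u i = 1\<^sub>m (2 * n) *\<^sub>v ?u i"
      using half[OF i, of d] eps_neq_uminus[OF i] by auto
  qed
  show "g ^\<^sub>m d \<noteq> 1\<^sub>m (2 * n)"
  proof
    assume g1: "g ^\<^sub>m d = 1\<^sub>m (2 * n)"
    \<comment> \<open>If all signs on the basis vectors are positive, so are all signs on the
      weights, and half the order of \<open>w\<close> would already give the identity.\<close>
    have "w ^\<^sub>m e = 1\<^sub>m n"
    proof (rule eps_ext[OF pw one_carrier_mat])
      fix i assume i: "i < 2 * n"
      show "w ^\<^sub>m e *\<^sub>v eps n i = 1\<^sub>m n *\<^sub>v eps n i"
        using half[OF i we] u_neq[OF i] g1 by (auto simp: de)
    qed
    thus False using W(1,3) de by (auto dest: dvd_imp_le)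
  qed
  show "g ^\<^sub>m d = - 1\<^sub>m (2 * n) \<longleftrightarrow> w ^\<^sub>m (d div 2) = - 1\<^sub>m n"
    unfolding e_def[symmetric]
  proof
    assume g1: "g ^\<^sub>m d = - 1\<^sub>m (2 * n)"
    show "w ^\<^sub>m e = - 1\<^sub>m n"
    proof (rule eps_ext[OF pw])
      fix i assume i: "i < 2 * n"
      show "w ^\<^sub>m e *\<^sub>v eps n i = - 1\<^sub>m n *\<^sub>v eps n i"
        using half[OF i we] u_neq[OF i] g1 by (auto simp: de)
    qed simp
  next
    assume w1: "w ^\<^sub>m e = - 1\<^sub>m n"
    show "g ^\<^sub>m d = - 1\<^sub>m (2 * n)"
    proof (rule mult_mat_vec_ext[OF pg])
      fix i assume i: "i < 2 * n"
      show "g ^\<^sub>m d *\<^sub>v ?u i = - 1\<^sub>m (2 * n) *\<^sub>v ?u i"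
        using half[OF i we] eps_neq_uminus[OF i] w1 by (auto simp: de)
    qed simp
  qed
qed

text \<open>The order is a multiple of \<open>d\<close>, divides \<open>2 * d\<close> and differs
  from \<open>d\<close>.\<close>

lemma ord_Sp_lift:
  fixes g :: "'k::field mat"
  assumes char: "(1::'k) \<noteq> - 1" and n: "n > 0"
    and w: "w \<in> carrier (weyl_C n)" and ell: "elliptic w"
    and g: "g \<in> carrier (Sp ty n)" "lifts n g w"
  shows "group.ord (Sp ty n) g = 2 * group.ord (weyl_C n) w"
proof -
  interpret group "Sp ty n" by (rule Sp_group)
  define d where "d = group.ord (weyl_C n) w"
  have d0: "d > 0" using elliptic_weyl_C_facts(1)[OF w ell n] by (simp add: d_def)
  note L = lifts_elliptic_pow[OF char n w ell g, folded d_def]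
  have pow: "g ^\<^sub>m m = 1\<^sub>m (2 * n) \<longleftrightarrow> ord g dvd m" for m
    using pow_eq_id[OF g(1), of m] by (simp add: Sp_pow[OF g(1)])
  have "d dvd ord g" using L(1)[of "ord g"] pow[of "ord g"] by (simp add: Sp_centre_def)
  then obtain q where q: "ord g = d * q" by (auto simp: dvd_def)
  have "q dvd 2" using L(2) pow[of "2 * d"] d0 by (simp add: q mult.commute[of 2])
  moreover have "q \<noteq> 1" using L(3) pow[of d] q by auto
  ultimately have "q = 2" using prime_nat_iff two_is_prime_nat by auto
  thus ?thesis using q by (simp add: d_def)
qed

text \<open>The order of the coset is a multiple of \<open>d\<close>, hence equal to
  \<open>d\<close> exactly when the \<open>d\<close>-th power of \<open>g\<close> is central. That
  power is not 1, so it must be -1.\<close>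

lemma ord_PSp_lift_iff:
  fixes g :: "'k::field mat"
  assumes char: "(1::'k) \<noteq> - 1" and n: "n > 0"
    and w: "w \<in> carrier (weyl_C n)" and ell: "elliptic w"
    and g: "g \<in> carrier (Sp ty n)" "lifts n g w"
  shows "group.ord (PSp ty n) (Sp_centre ty n #>\<^bsub>Sp ty n\<^esub> g) = group.ord (weyl_C n) w \<longleftrightarrow>
    (\<exists>r::int. w [^]\<^bsub>weyl_C n\<^esub> r = - 1\<^sub>m n)"
proof -
  interpret group "PSp ty n" by (rule PSp_group)
  let ?X = "Sp_centre ty n #>\<^bsub>Sp ty n\<^esub> g"
  define d where "d = group.ord (weyl_C n) w"
  note L = lifts_elliptic_pow[OF char n w ell g, folded d_def]
  have X: "?X \<in> carrier (PSp ty n)" using g by (auto simp: PSp_carrier)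
  have pow: "g ^\<^sub>m m \<in> Sp_centre ty n \<longleftrightarrow> ord ?X dvd m" for m
    using pow_eq_id[OF X, of m] PSp_pow_eq_one_iff[OF g(1), of m] by simp
  have "d dvd ord ?X" using L(1)[of "ord ?X"] pow[of "ord ?X"] by simp
  hence "ord ?X = d \<longleftrightarrow> g ^\<^sub>m d \<in> Sp_centre ty n" using pow[of d] by (auto intro: dvd_antisym)
  also have "\<dots> \<longleftrightarrow> w ^\<^sub>m (d div 2) = - 1\<^sub>m n" using L(3,4) by (simp add: Sp_centre_def)
  also have "\<dots> \<longleftrightarrow> (\<exists>r::int. w [^]\<^bsub>weyl_C n\<^esub> r = - 1\<^sub>m n)"
    using elliptic_weyl_C_facts(5)[OF w ell n] by (simp add: d_def)
  finally show ?thesis by (simp add: d_def)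
qed

lemma one_neq_uminus_one:
  assumes "CHAR('k::field) \<noteq> 2"
  shows "(1::'k) \<noteq> - 1"
proof
  assume "(1::'k) = - 1"
  hence "of_nat 2 = (0::'k)" by (simp add: eq_neg_iff_add_eq_0)
  hence "CHAR('k) dvd 2" by (simp only: of_nat_eq_0_iff_char_dvd)
  hence "CHAR('k) = 1" using assms by (metis prime_nat_iff two_is_prime_nat)
  thus False using of_nat_CHAR[where 'a = 'k] by simp
qed

theorem theorem4p6:
  fixes n :: nat and w :: "real mat"
  assumes "CHAR('k::alg_closed_field) \<noteq> 2"
    and "n > 1"
    and "w \<in> carrier (weyl_C n)"
    and "elliptic w"
  shows "universal_spin TYPE('k) n w (- 1) \<and>
    (adjoint_spin TYPE('k) n w 1 \<longleftrightarrow> (\<exists>r::int. w [^]\<^bsub>weyl_C n\<^esub> r = - 1\<^sub>m n))"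
proof
  have sp: "signed_perm n w" by (rule weyl_C_carrierD[OF assms(3)])
  have char: "(1::'k) \<noteq> - 1" by (rule one_neq_uminus_one[OF assms(1)])
  have n: "n > 0" using assms(2) by simp
  show "universal_spin TYPE('k) n w (- 1)"
    unfolding universal_spin_def has_spin_def
    using ord_Sp_lift[OF char n assms(3,4) Sp_reps_lifts[OF sp]] by blast
  \<comment> \<open>The right-hand side does not mention \<open>X\<close>, so a single
    representative decides for all of them.\<close>
  have ord: "group.ord (PSp TYPE('k) n) X = group.ord (weyl_C n) w \<longleftrightarrow>
      (\<exists>r::int. w [^]\<^bsub>weyl_C n\<^esub> r = - 1\<^sub>m n)" if "X \<in> PSp_reps TYPE('k) n w" for X
    using PSp_reps_lifts[OF sp that] ord_PSp_lift_iff[OF char n assms(3,4)] by blast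
  show "adjoint_spin TYPE('k) n w 1 \<longleftrightarrow> (\<exists>r::int. w [^]\<^bsub>weyl_C n\<^esub> r = - 1\<^sub>m n)"
    unfolding adjoint_spin_def has_spin_def
    using ord PSp_reps_nonempty[OF assms(3), of "TYPE('k)"] by auto
qed

end
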